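(* Let $\Omega$ be a bounded open set in $\mathbb{R}^d$ with finite perimeter. Let $X=(X_t)_{t\ge0}$ be a translation invariant isotropic process on $\mathbb{R}^d$ with càdlàg paths such that, for every $\varepsilon>0$, $$\lim_{t\downarrow 0}\frac{1}{\mu(t)}\,\mathbb{P}_0\Big(\sup_{0\le s\le t}X^{(1)}_s>\varepsilon\Big)=0,\qquad\text{where}\quad \mu(t)=\mathbb{E}_0\Big[\Big(\sup_{0\le s\le t}X^{(1)}_s\Big)\wedge 1\Big].$$ Then $$\liminf_{t\downarrow0}\frac{\mathrm{Vol}(\Omega)-Q^X_\Omega(t)}{\mu(t)}\ge\mathrm{Per}(\Omega).$$
   Context: $X=(X_t)_{t\ge0}$, $X_t=(X^{(1)}_t,\dots,X^{(d)}_t)$, is an $\mathbb{R}^d$-valued stochastic process with càdlàg paths; $\mathbb{P}_x$ (expectation $\mathbb{E}_x$) denotes the probability measure when $X_0=x$. Translation invariant isotropic means: for any $t\ge0$, $x\in\mathbb{R}^d$ and Borel set $A\subset\mathbb{R}^d$, $\mathbb{P}_x(X_t\in A)=\mathbb{P}_0(X_t+x\in A)$ and $\mathbb{P}_0(X_t\in A)=\mathbb{P}_0(UX_t\in A)$ for all $d\times d$ orthogonal matrices $U$. The spectral heat content of a bounded open set $\Omega\subset\mathbb{R}^d$ is $Q^X_\Omega(t)=\int_\Omega\mathbb{P}_x(\tau^X_\Omega>t)\,dx$, where $\tau^X_\Omega=\inf\{t\ge0:X_t\notin\Omega\}$. $\mathrm{Vol}(\Omega)$ is the volume of $\Omega$.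 The perimeter is $\mathrm{Per}(\Omega)=\sup\{\int_\Omega\sum_{i=1}^dD_i\varphi_i\,dx:\ \varphi_i\in C_c^\infty(\mathbb{R}^d),\ \sum_{i=1}^d\varphi_i^2\le1\}$; $\Omega$ has finite perimeter if this is finite.
   Formalization: Translation invariance and isotropy are required of the law of the whole process (all finite-dimensional distributions), not only of each single X_t, since with one-time marginals the claim fails already for Ω=(0,1); also μ(t)>0 for small t is assumed so that the quotients make sense. *)

theory Defs
  imports "HOL-Probability.Probability"
begin

section \<open>Translation invariant isotropic processes\<close>

definition cadlag :: "(real \<Rightarrow> 'a::topological_space) \<Rightarrow> bool" where
  "cadlag f \<longleftrightarrow> (\<forall>t\<ge>0. (f \<longlongrightarrow> f t) (at_right t)) \<and> (\<forall>t>0. \<exists>l. (f \<longlongrightarrow> l) (at_left t))"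

text \<open>
  A process is a family \<open>X t\<close> (only \<open>t \<ge> 0\<close> matters) on one measurable space carrying the
  probability measures \<open>P x\<close>.
\<close>

definition cadlag_process ::
    "(real^'n \<Rightarrow> 'w measure) \<Rightarrow> (real \<Rightarrow> 'w \<Rightarrow> real^'n) \<Rightarrow> bool" where
  "cadlag_process P X \<longleftrightarrow>
     (\<forall>x. prob_space (P x)) \<and>
     (\<forall>x. sets (P x) = sets (P 0)) \<and>
     (\<forall>t\<ge>0. X t \<in> borel_measurable (P 0)) \<and>
     (\<forall>\<omega>\<in>space (P 0). cadlag (\<lambda>t. X t \<omega>)) \<and>
     (\<forall>x. AE \<omega> in P x. X 0 \<omega> = x)"

definition process_law :: "'w measure \<Rightarrow> (real \<Rightarrow> 'w \<Rightarrow> real^'n) \<Rightarrow> (real \<Rightarrow> real^'n) measure" where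
  "process_law M X = distr M (\<Pi>\<^sub>M t\<in>{0..}. borel) (\<lambda>\<omega>. \<lambda>t\<in>{0..}. X t \<omega>)"

text \<open>
  The two invariances are those of the law of the process, that is, of all its finite-dimensional
  distributions.  Invariance of the laws of the single variables \<open>X t\<close> would not constrain
  running suprema or exit times: for \<open>d = 1\<close>, the process \<open>X t = x + \<xi> t\<close> with one random sign
  \<open>\<xi>\<close>, and the process whose sign is resampled independently on each interval
  \<open>[q^(k+1), q^k)\<close>, have the same one-time marginals, but different expected running suprema.
\<close>

definition translation_invariant ::
    "(real^'n \<Rightarrow> 'w measure) \<Rightarrow> (real \<Rightarrow> 'w \<Rightarrow> real^'n) \<Rightarrow> bool" where
  "translation_invariant P X \<longleftrightarrow>
     (\<forall>x. process_law (P x) X = process_law (P 0) (\<lambda>t \<omega>. X t \<omega> + x))"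

definition isotropic ::
    "(real^'n \<Rightarrow> 'w measure) \<Rightarrow> (real \<Rightarrow> 'w \<Rightarrow> real^'n) \<Rightarrow> bool" where
  "isotropic P X \<longleftrightarrow>
     (\<forall>U :: real^'n^'n. orthogonal_matrix U \<longrightarrow>
        process_law (P 0) X = process_law (P 0) (\<lambda>t \<omega>. U *v X t \<omega>))"

definition running_sup :: "(real \<Rightarrow> 'w \<Rightarrow> real^'n) \<Rightarrow> 'n \<Rightarrow> real \<Rightarrow> 'w \<Rightarrow> real" where
  "running_sup X i t \<omega> = (SUP s\<in>{0..t}. X s \<omega> $ i)"

definition mean_running_sup ::
    "(real^'n \<Rightarrow> 'w measure) \<Rightarrow> (real \<Rightarrow> 'w \<Rightarrow> real^'n) \<Rightarrow> 'n \<Rightarrow> real \<Rightarrow> real" where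
  "mean_running_sup P X i t = (LINT \<omega>|P 0. min (running_sup X i t \<omega>) 1)"

section \<open>Spectral heat content\<close>

definition exit_time :: "(real \<Rightarrow> 'w \<Rightarrow> real^'n) \<Rightarrow> (real^'n) set \<Rightarrow> 'w \<Rightarrow> ereal" where
  "exit_time X D \<omega> = Inf {ereal t | t. 0 \<le> t \<and> X t \<omega> \<notin> D}"

text \<open>
  For an open set and a cadlag process, the event that the exit time exceeds \<open>t\<close> is
  co-analytic.  It need not belong to the original sigma-algebra but does belong to its
  completion under each \<open>P x\<close>; likewise its probability is a Lebesgue (not necessarily Borel)
  measurable function of the starting point when the process is translation invariant.
\<close>

definition spectral_heat_content ::
    "(real^'n \<Rightarrow> 'w measure) \<Rightarrow> (real \<Rightarrow> 'w \<Rightarrow> real^'n) \<Rightarrow> (real^'n) set \<Rightarrow> real \<Rightarrow> real" where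
  "spectral_heat_content P X D t =
     (LINT x:D|lebesgue.
        measure (completion (P x)) {\<omega> \<in> space (P x). ereal t < exit_time X D \<omega>})"

section \<open>Perimeter\<close>

definition partial_deriv :: "'n \<Rightarrow> (real^'n \<Rightarrow> real) \<Rightarrow> real^'n \<Rightarrow> real" where
  "partial_deriv i f x = frechet_derivative f (at x) (axis i 1)"

fun Ck :: "nat \<Rightarrow> (real^'n \<Rightarrow> real) \<Rightarrow> bool" where
  "Ck 0 f \<longleftrightarrow> continuous_on UNIV f"
| "Ck (Suc k) f \<longleftrightarrow> (\<forall>x. f differentiable (at x)) \<and> (\<forall>i. Ck k (partial_deriv i f))"

definition test_function :: "(real^'n \<Rightarrow> real) \<Rightarrow> bool" where
  "test_function f \<longleftrightarrow> (\<forall>k. Ck k f) \<and> compact (closure {x. f x \<noteq> 0})"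

definition perimeter :: "(real^'n) set \<Rightarrow> ereal" where
  "perimeter D =
     (SUP \<phi> \<in> {\<phi> :: real^'n \<Rightarrow> real^'n.
                  (\<forall>i. test_function (\<lambda>x. \<phi> x $ i)) \<and> (\<forall>x. (\<Sum>i\<in>UNIV. (\<phi> x $ i)\<^sup>2) \<le> 1)}.
        ereal (LINT x:D|lebesgue. (\<Sum>i\<in>UNIV. partial_deriv i (\<lambda>y. \<phi> y $ i) x)))"

end

theory Submission
  imports Defs
begin

text \<open>
  Let \<open>M t\<close> be the running supremum of one coordinate and \<open>\<mu> t\<close> its truncated mean.  By translation
  invariance and Fubini, the heat loss \<open>measure D - Q t\<close> is the expected volume of the points
  \<open>x \<in> D\<close> such that \<open>x + X s \<notin> D\<close> for some \<open>s \<le> t\<close>.  Looking at the path only at finitely many times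
  makes this volume smaller, so that a lower bound for the sampled volume suffices; the sampled
  events are measurable.

  Let \<open>\<psi> j \<ge> 0\<close> be finitely many continuously differentiable functions with \<open>(\<Sum>j. \<psi> j) \<le> 1\<close>, and for
  each \<open>j\<close> let \<open>y j\<close> be \<open>0\<close> or one of the positions of the path.  If \<open>x \<in> D\<close> does not leave \<open>D\<close> along the
  path, then \<open>x + y j \<in> D\<close> for all \<open>j\<close>; hence the exit volume is at least
  \<open>\<Sum>j. \<integral> \<psi> j x * (1\<^sub>D x - 1\<^sub>D (x + y j)) dx = \<Sum>j. \<integral>\<^sub>D \<psi> j x - \<psi> j (x - y j) dx\<close>
  (\<open>exit_volume_lower_bound\<close>), which to first order is \<open>\<Sum>j. (\<integral>\<^sub>D grad (\<psi> j)) \<bullet> y j\<close>.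

  Fix a unit vector \<open>\<nu> j\<close> and take for \<open>y j\<close> the sampled position that is farthest in direction \<open>\<nu> j\<close>,
  replaced by \<open>0\<close> if the path leaves a small ball.  The law of the path is invariant under the
  orthogonal map that fixes \<open>\<nu> j\<close> and reverses its orthogonal complement, so the mean of \<open>y j\<close> is
  parallel to \<open>\<nu> j\<close>; if the sampling times are dense enough, its length is \<open>\<mu> t\<close> up to \<open>o(\<mu> t)\<close>, because
  the probability to leave the ball is \<open>o(\<mu> t)\<close> by the hypothesis on \<open>M t\<close>.
  Moreover the mean of \<open>norm (y j)\<close> is at most \<open>2 d \<mu> t\<close>, which absorbs the error of the first-order
  expansion.  Hence
  \<open>Liminf ((measure D - Q t) / \<mu> t) \<ge> \<Sum>j. \<integral>\<^sub>D grad (\<psi> j) \<bullet> \<nu> j\<close>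
  (\<open>heat_loss_directional_lower_bound\<close>).

  The right-hand side is \<open>\<integral>\<^sub>D div (\<Sum>j. \<psi> j \<nu> j)\<close>.  Given a test field \<open>\<phi>\<close> with \<open>norm \<phi> \<le> 1\<close> and \<open>c > 1\<close>,
  the field \<open>\<phi> / c\<close> is exactly of the form \<open>\<Sum>j. \<psi> j \<nu> j\<close>: tensor products of Bernstein polynomials
  reproduce linear functions, so that \<open>v = (\<Sum>w. \<theta> w v * w)\<close> with \<open>w\<close> running through a grid in the cube
  \<open>[-1, 1]^d\<close> and \<open>\<theta> w \<ge> 0\<close> summing to \<open>1\<close>, and since the variance of the Bernstein weights
  is small, \<open>(\<Sum>w. \<theta> w v * norm w) \<le> 1 + d / n\<close> on the unit ball (\<open>directional_decomposition\<close>).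
  Letting \<open>c\<close> tend to \<open>1\<close> and taking the supremum over \<open>\<phi>\<close> gives the perimeter.
\<close>

section \<open>Continuously differentiable functions with a given gradient\<close>

text \<open>\<open>f\<close> is continuously differentiable on the whole space and its gradient is \<open>g\<close>.\<close>

definition C1_gradient :: "('a::euclidean_space \<Rightarrow> real) \<Rightarrow> ('a \<Rightarrow> 'a) \<Rightarrow> bool" where
  "C1_gradient f g \<longleftrightarrow>
     (\<forall>x. (f has_derivative (\<lambda>h. g x \<bullet> h)) (at x)) \<and> continuous_on UNIV g"

lemma C1_gradient_continuous:
  assumes "C1_gradient f g"
  shows "continuous_on UNIV f" "continuous_on UNIV g"
  using assms unfolding C1_gradient_def
  by (auto simp: continuous_on_eq_continuous_at intro: has_derivative_continuous)

lemma C1_gradient_const: "C1_gradient (\<lambda>x. c) (\<lambda>x. 0)"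
  by (simp add: C1_gradient_def)

lemma C1_gradient_add:
  assumes "C1_gradient f g" "C1_gradient f' g'"
  shows "C1_gradient (\<lambda>x. f x + f' x) (\<lambda>x. g x + g' x)"
  using assms unfolding C1_gradient_def
  by (auto intro!: derivative_eq_intros continuous_intros simp: inner_add_left)

lemma C1_gradient_mult:
  assumes "C1_gradient f g" "C1_gradient f' g'"
  shows "C1_gradient (\<lambda>x. f x * f' x) (\<lambda>x. f x *\<^sub>R g' x + f' x *\<^sub>R g x)"
  using assms C1_gradient_continuous(1)[OF assms(1)] C1_gradient_continuous(1)[OF assms(2)]
  unfolding C1_gradient_def
  by (auto intro!: derivative_eq_intros continuous_intros simp: inner_add_left algebra_simps)

lemma C1_gradient_cmult:
  assumes "C1_gradient f g"
  shows "C1_gradient (\<lambda>x. c * f x) (\<lambda>x. c *\<^sub>R g x)"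
  using C1_gradient_mult[OF C1_gradient_const assms, of c] by simp

lemma C1_gradient_power:
  assumes "C1_gradient f g"
  shows "\<exists>g'. C1_gradient (\<lambda>x. f x ^ n) g'"
proof (induction n)
  case 0
  show ?case using C1_gradient_const[of 1] by auto
next
  case (Suc n)
  then show ?case using C1_gradient_mult[OF assms] by auto
qed

lemma C1_gradient_prod:
  assumes "finite I" "\<And>k. k \<in> I \<Longrightarrow> \<exists>g. C1_gradient (f k) g"
  shows "\<exists>g. C1_gradient (\<lambda>x. \<Prod>k\<in>I. f k x) g"
  using assms
proof (induction I rule: finite_induct)
  case empty
  show ?case using C1_gradient_const[of 1] by auto
next
  case (insert k I)
  obtain g where "C1_gradient (f k) g" using insert.prems by auto
  moreover obtain g' where "C1_gradient (\<lambda>x. \<Prod>k\<in>I. f k x) g'"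
    using insert by auto
  ultimately show ?case using C1_gradient_mult insert.hyps by fastforce
qed

lemma C1_gradient_Bernstein:
  assumes "C1_gradient f g"
  shows "\<exists>g'. C1_gradient (\<lambda>x. Bernstein n k (f x)) g'"
proof -
  have "C1_gradient (\<lambda>x. 1 - f x) (\<lambda>x. - g x)"
    using C1_gradient_add[OF C1_gradient_const C1_gradient_cmult[OF assms], of 1 "- 1"] by simp
  from C1_gradient_power[OF this] obtain g1 where "C1_gradient (\<lambda>x. (1 - f x) ^ (n - k)) g1"
    by blast
  moreover from C1_gradient_power[OF assms] obtain g2 where "C1_gradient (\<lambda>x. f x ^ k) g2"
    by blast
  ultimately show ?thesis
    unfolding Bernstein_def using C1_gradient_mult C1_gradient_cmult by blast
qed

text \<open>First-order expansion at \<open>x\<close> along \<open>- y\<close>, uniformly in \<open>x \<in> D\<close>.\<close>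

lemma C1_gradient_taylor:
  fixes f :: "'a::euclidean_space \<Rightarrow> real"
  assumes "C1_gradient f g" "bounded D" "\<eta> > 0"
  shows "\<exists>\<rho>>0. \<forall>x\<in>D. \<forall>y. norm y \<le> \<rho> \<longrightarrow> \<bar>f x - f (x - y) - g x \<bullet> y\<bar> \<le> \<eta> * norm y"
proof -
  from \<open>bounded D\<close> obtain B where B: "\<And>x. x \<in> D \<Longrightarrow> norm x \<le> B"
    by (auto simp: bounded_iff)
  have "uniformly_continuous_on (cball 0 (B + 1)) g"
    using C1_gradient_continuous(2)[OF assms(1)]
    by (intro compact_uniformly_continuous) (auto intro: continuous_on_subset)
  then obtain \<delta> where \<delta>: "\<delta> > 0"
    "\<And>x x'. x \<in> cball 0 (B + 1) \<Longrightarrow> x' \<in> cball 0 (B + 1) \<Longrightarrow> dist x' x < \<delta> \<Longrightarrow> dist (g x') (g x) < \<eta>"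
    unfolding uniformly_continuous_on_def using \<open>\<eta> > 0\<close> by metis
  define \<rho> where "\<rho> = min 1 (\<delta> / 2)"
  have \<rho>: "\<rho> > 0" "\<rho> \<le> 1" "\<rho> < \<delta>" using \<delta>(1) by (auto simp: \<rho>_def)
  have "\<bar>f x - f (x - y) - g x \<bullet> y\<bar> \<le> \<eta> * norm y" if x: "x \<in> D" and y: "norm y \<le> \<rho>" for x y
  proof -
    have sub: "cball x \<rho> \<subseteq> cball 0 (B + 1)"
    proof
      fix z assume "z \<in> cball x \<rho>"
      moreover have "norm z \<le> norm x + norm (z - x)" by (simp add: norm_triangle_sub)
      ultimately show "z \<in> cball 0 (B + 1)"
        using B[OF x] \<rho>(2) by (simp add: dist_norm norm_minus_commute)
    qed
    have "norm (f (x - y) - f x - g x \<bullet> ((x - y) - x)) \<le> norm ((x - y) - x) * \<eta>"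
    proof (rule differentiable_bound_linearization[where S = "cball x \<rho>" and f' = "\<lambda>x h. g x \<bullet> h"])
      fix t :: real assume "t \<in> {0..1}"
      then have "\<bar>t\<bar> * norm y \<le> 1 * \<rho>" using y by (intro mult_mono) auto
      then show "x + t *\<^sub>R (x - y - x) \<in> cball x \<rho>" by (simp add: dist_norm)
    next
      fix z show "(f has_derivative (\<lambda>h. g z \<bullet> h)) (at z within cball x \<rho>)"
        using assms(1) by (auto simp: C1_gradient_def intro: has_derivative_at_withinI)
    next
      fix z assume z: "z \<in> cball x \<rho>"
      show "onorm ((\<lambda>h. g z \<bullet> h) - (\<lambda>h. g x \<bullet> h)) \<le> \<eta>"
      proof (rule onorm_bound)
        fix h
        have "dist (g z) (g x) < \<eta>"
          using z sub \<rho> \<delta>(2)[of x z] centre_in_cball[of x \<rho>]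
          by (simp add: dist_commute subset_iff del: mem_cball_0 centre_in_cball)
        then have "norm (g z - g x) \<le> \<eta>" by (simp add: dist_norm)
        moreover have "\<bar>(g z - g x) \<bullet> h\<bar> \<le> norm (g z - g x) * norm h"
          by (rule Cauchy_Schwarz_ineq2)
        ultimately show "norm (((\<lambda>h. g z \<bullet> h) - (\<lambda>h. g x \<bullet> h)) h) \<le> \<eta> * norm h"
          by (simp add: inner_diff_left) (meson mult_right_mono norm_ge_zero order_trans)
      qed (use \<open>\<eta> > 0\<close> in auto)
    qed (use \<rho> in auto)
    then show ?thesis by (simp add: abs_minus_commute algebra_simps)
  qed
  with \<rho>(1) show ?thesis by blast
qed

lemma test_function_C1_gradient:
  assumes "test_function f"
  shows "C1_gradient f (\<lambda>x. \<chi> i. partial_deriv i f x)"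
proof -
  have C: "Ck (Suc 0) f" using assms by (simp add: test_function_def)
  have "(f has_derivative (\<lambda>h. (\<chi> i. partial_deriv i f x) \<bullet> h)) (at x)" for x
  proof -
    let ?L = "frechet_derivative f (at x)"
    have d: "(f has_derivative ?L) (at x)" using C by (simp add: frechet_derivative_works)
    then have lin: "linear ?L" by (rule has_derivative_linear)
    have "?L h = (\<chi> i. partial_deriv i f x) \<bullet> h" for h
    proof -
      have "?L h = ?L (\<Sum>i\<in>UNIV. h $ i *\<^sub>R axis i 1)"
        by (simp add: basis_expansion flip: scalar_mult_eq_scaleR)
      also have "\<dots> = (\<Sum>i\<in>UNIV. h $ i * ?L (axis i 1))"
        by (simp add: linear_sum[OF lin] linear_scale[OF lin])
      finally show ?thesis by (simp add: inner_vec_def partial_deriv_def mult.commute)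
    qed
    then have "?L = (\<lambda>h. (\<chi> i. partial_deriv i f x) \<bullet> h)" by blast
    with d show ?thesis by simp
  qed
  moreover have "continuous_on UNIV (\<lambda>x. \<chi> i. partial_deriv i f x)"
    using C by (intro continuous_on_vec_lambda) auto
  ultimately show ?thesis by (auto simp: C1_gradient_def)
qed

section \<open>Bernstein decomposition of a vector field into fixed directions\<close>

text \<open>
  The affine map \<open>k \<mapsto> 2 k / n - 1\<close> carries the nodes \<open>0, \<dots>, n\<close> into \<open>[-1, 1]\<close>, and \<open>(1 + v) / 2\<close> is the
  parameter that makes the mean of the binomial weights on these nodes equal to \<open>v\<close>.
\<close>

lemma sum_affine_Bernstein:
  assumes "n > 0"
  shows "(\<Sum>k\<le>n. (2 * real k / n - 1) * Bernstein n k ((1 + v) / 2)) = v"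
proof -
  let ?B = "\<lambda>k. Bernstein n k ((1 + v) / 2)"
  have "(\<Sum>k\<le>n. (2 * real k / n - 1) * ?B k) = 2 / n * (\<Sum>k\<le>n. real k * ?B k) - (\<Sum>k\<le>n. ?B k)"
    unfolding sum_distrib_left sum_subtractf[symmetric] by (intro sum.cong) (auto simp: algebra_simps)
  also have "\<dots> = 2 / n * (n * ((1 + v) / 2)) - 1"
    by (simp only: sum_Bernstein sum_k_Bernstein)
  also have "\<dots> = v" using assms by (simp add: field_simps)
  finally show ?thesis .
qed

lemma sum_affine_square_Bernstein:
  assumes "n > 0"
  shows "(\<Sum>k\<le>n. (2 * real k / n - 1)\<^sup>2 * Bernstein n k ((1 + v) / 2)) \<le> v\<^sup>2 + 1 / n"
proof -
  let ?p = "(1 + v) / 2"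
  let ?B = "\<lambda>k. Bernstein n k ?p"
  have "(\<Sum>k\<le>n. (2 * real k / n - 1)\<^sup>2 * ?B k)
      = (\<Sum>k\<le>n. 4 / n\<^sup>2 * (real k * (real k - 1) * ?B k) + (4 / n\<^sup>2 - 4 / n) * (real k * ?B k) + ?B k)"
    using assms by (intro sum.cong) (auto simp: field_simps power2_eq_square)
  also have "\<dots> = 4 / n\<^sup>2 * (\<Sum>k\<le>n. real k * (real k - 1) * ?B k)
      + (4 / n\<^sup>2 - 4 / n) * (\<Sum>k\<le>n. real k * ?B k) + (\<Sum>k\<le>n. ?B k)"
    by (simp only: sum.distrib sum_distrib_left)
  also have "\<dots> = 4 / n\<^sup>2 * (real n * (real n - 1) * ?p\<^sup>2) + (4 / n\<^sup>2 - 4 / n) * (n * ?p) + 1"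
    by (simp only: sum_Bernstein sum_k_Bernstein sum_kk_Bernstein)
  also have "\<dots> = v\<^sup>2 + (1 - v\<^sup>2) / n"
    using assms by (simp add: field_simps power2_eq_square)
  also have "\<dots> \<le> v\<^sup>2 + 1 / n" by (intro add_left_mono divide_right_mono) auto
  finally show ?thesis .
qed

text \<open>The point of the grid of mesh \<open>2 / n\<close> in the cube \<open>[-1, 1]^d\<close> with multi-index \<open>m\<close>.\<close>

definition grid_point :: "nat \<Rightarrow> ('n \<Rightarrow> nat) \<Rightarrow> real^'n" where
  "grid_point n m = (\<chi> i. 2 * real (m i) / n - 1)"

text \<open>The weight of the grid point \<open>m\<close> at \<open>v\<close>: a product of one-dimensional Bernstein weights.\<close>

definition tensor_Bernstein :: "nat \<Rightarrow> ('n \<Rightarrow> nat) \<Rightarrow> real^'n \<Rightarrow> real" where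
  "tensor_Bernstein n m v = (\<Prod>i\<in>UNIV. Bernstein n (m i) ((1 + v $ i) / 2))"

text \<open>The multi-indices with all entries in \<open>{0, \<dots>, n}\<close>.\<close>

abbreviation grid :: "nat \<Rightarrow> ('n \<Rightarrow> nat) set" where
  "grid n \<equiv> PiE UNIV (\<lambda>_. {..n})"

lemma finite_grid: "finite (grid n :: ('n::finite \<Rightarrow> nat) set)"
  by (intro finite_PiE) auto

lemma tensor_Bernstein_nonneg:
  assumes "\<And>i. \<bar>v $ i\<bar> \<le> 1"
  shows "tensor_Bernstein n m v \<ge> 0"
proof -
  have "0 \<le> (1 + v $ i) / 2 \<and> (1 + v $ i) / 2 \<le> 1" for i using assms[of i] by (simp add: abs_le_iff)
  then show ?thesis
    unfolding tensor_Bernstein_def by (intro prod_nonneg ballI Bernstein_nonneg) blast+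
qed

text \<open>Marginals of the product weights: the weights in the other coordinates sum to one.\<close>

lemma sum_tensor_Bernstein_coordinate:
  fixes v :: "real^'n"
  shows "(\<Sum>m\<in>grid n. h (m i) * tensor_Bernstein n m v) = (\<Sum>k\<le>n. h k * Bernstein n k ((1 + v $ i) / 2))"
proof -
  let ?f = "\<lambda>j k. (if j = i then h k else 1) * Bernstein n k ((1 + v $ j) / 2)"
  have "(\<Sum>m\<in>grid n. h (m i) * tensor_Bernstein n m v) = (\<Sum>m\<in>grid n. \<Prod>j\<in>UNIV. ?f j (m j))"
    by (simp add: tensor_Bernstein_def prod.distrib)
  also have "\<dots> = (\<Prod>j\<in>UNIV. \<Sum>k\<le>n. ?f j k)"
    by (rule prod_sum_PiE[symmetric]) auto
  also have "\<dots> = (\<Prod>j\<in>UNIV. if j = i then (\<Sum>k\<le>n. h k * Bernstein n k ((1 + v $ i) / 2)) else 1)"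
    by (intro prod.cong) auto
  finally show ?thesis by simp
qed

lemma sum_tensor_Bernstein_grid_point:
  fixes v :: "real^'n"
  assumes "n > 0"
  shows "(\<Sum>m\<in>grid n. tensor_Bernstein n m v *\<^sub>R grid_point n m) = v"
proof (rule vec_eq_iff[THEN iffD2], rule allI)
  fix i
  show "(\<Sum>m\<in>grid n. tensor_Bernstein n m v *\<^sub>R grid_point n m) $ i = v $ i"
    using sum_tensor_Bernstein_coordinate[of "\<lambda>k. 2 * real k / n - 1" i n v]
      sum_affine_Bernstein[OF assms, of "v $ i"]
    by (simp add: grid_point_def mult.commute)
qed

lemma sum_tensor_Bernstein_norm_grid_point:
  fixes v :: "real^'n"
  assumes "n > 0" "norm v \<le> 1"
  shows "(\<Sum>m\<in>grid n. tensor_Bernstein n m v * norm (grid_point n m :: real^'n)) \<le> 1 + CARD('n) / n"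
proof -
  let ?T = "\<lambda>m. tensor_Bernstein n m v"
  have nn: "?T m \<ge> 0" for m
    using assms(2) by (intro tensor_Bernstein_nonneg) (meson component_le_norm_cart order_trans)
  have sq: "norm x ^ 2 = (\<Sum>i\<in>UNIV. (x $ i)\<^sup>2)" for x :: "real^'n"
    unfolding power2_norm_eq_inner by (simp add: inner_vec_def power2_eq_square)
  have one: "(\<Sum>m\<in>grid n. ?T m) = 1"
    using sum_tensor_Bernstein_coordinate[of "\<lambda>_. 1" undefined n v] by simp
  have "(\<Sum>m\<in>grid n. ?T m * norm (grid_point n m :: real^'n) ^ 2)
      = (\<Sum>i\<in>UNIV. \<Sum>m\<in>grid n. (2 * real (m i) / n - 1)\<^sup>2 * ?T m)"
    unfolding sq sum_distrib_left by (subst sum.swap) (simp add: grid_point_def mult.commute)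
  also have "\<dots> = (\<Sum>i\<in>UNIV. \<Sum>k\<le>n. (2 * real k / n - 1)\<^sup>2 * Bernstein n k ((1 + v $ i) / 2))"
    by (intro sum.cong refl sum_tensor_Bernstein_coordinate)
  also have "\<dots> \<le> (\<Sum>i\<in>UNIV. (v $ i)\<^sup>2 + 1 / n)"
    by (intro sum_mono sum_affine_square_Bernstein assms)
  also have "\<dots> = norm v ^ 2 + CARD('n) / n" by (simp add: sum.distrib sq)
  also have "\<dots> \<le> 1 + CARD('n) / n" using assms(2) by (simp add: power_le_one)
  finally have two: "(\<Sum>m\<in>grid n. ?T m * norm (grid_point n m :: real^'n) ^ 2) \<le> 1 + CARD('n) / n" .
  \<comment> \<open>\<open>r \<le> (1 + r\<^sup>2) / 2\<close> reduces the mean of the norm to its second moment.\<close>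
  have "(\<Sum>m\<in>grid n. ?T m * norm (grid_point n m :: real^'n))
      \<le> (\<Sum>m\<in>grid n. ?T m * ((1 + norm (grid_point n m :: real^'n) ^ 2) / 2))"
  proof (intro sum_mono mult_left_mono nn)
    fix m
    have "0 \<le> (1 - norm (grid_point n m :: real^'n))\<^sup>2" by simp
    then show "norm (grid_point n m :: real^'n) \<le> (1 + norm (grid_point n m :: real^'n) ^ 2) / 2"
      by (simp add: power2_eq_square algebra_simps)
  qed
  also have "\<dots> = ((\<Sum>m\<in>grid n. ?T m) + (\<Sum>m\<in>grid n. ?T m * norm (grid_point n m :: real^'n) ^ 2)) / 2"
    by (simp add: sum.distrib sum_divide_distrib[symmetric] distrib_left)
  also have "\<dots> \<le> 1 + CARD('n) / n"
  proof -
    have "(a + b) / 2 \<le> 1 + e" if "a = 1" "b \<le> 1 + e" "e \<ge> 0" for a b e :: real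
      using that by simp
    from this[OF one two] show ?thesis by simp
  qed
  finally show ?thesis .
qed

text \<open>
  The vector field \<open>\<phi> / c\<close> is the sum of the fields \<open>\<psi> j \<nu> j\<close>.  Only the resulting identity between the
  divergences is recorded.  The direction \<open>\<nu> j\<close> is the one of a nonzero grid point, and the length of
  that grid point is absorbed in \<open>\<psi> j\<close>.
\<close>

lemma directional_decomposition:
  fixes \<phi> :: "real^'n \<Rightarrow> real^'n"
  assumes C1: "\<And>i. C1_gradient (\<lambda>x. \<phi> x $ i) (G i)" and le1: "\<And>x. norm (\<phi> x) \<le> 1" and "c > 1"
  obtains J :: "('n \<Rightarrow> nat) set" and \<nu> :: "('n \<Rightarrow> nat) \<Rightarrow> real^'n" and \<psi> g where
    "finite J" "\<And>j. j \<in> J \<Longrightarrow> norm (\<nu> j) = 1"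
    "\<And>j. j \<in> J \<Longrightarrow> C1_gradient (\<psi> j) (g j)" "\<And>j x. j \<in> J \<Longrightarrow> \<psi> j x \<ge> 0"
    "\<And>x. (\<Sum>j\<in>J. \<psi> j x) \<le> 1"
    "\<And>x. c * (\<Sum>j\<in>J. g j x \<bullet> \<nu> j) = (\<Sum>i\<in>UNIV. G i x $ i)"
proof -
  obtain n :: nat where n: "real CARD('n) / (c - 1) < n" using reals_Archimedean2 by blast
  moreover have "real CARD('n) / (c - 1) > 0" using \<open>c > 1\<close> by simp
  ultimately have n0: "n > 0" by linarith
  have cn: "1 + CARD('n) / n \<le> c" using n n0 \<open>c > 1\<close> by (simp add: field_simps)
  let ?w = "\<lambda>m. grid_point n m :: real^'n"
  define \<theta> where "\<theta> m x = tensor_Bernstein n m (\<phi> x)" for m x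
  have "\<exists>g. C1_gradient (\<theta> m) g" for m
  proof -
    have "\<exists>g. C1_gradient (\<lambda>x. Bernstein n (m i) ((1 + \<phi> x $ i) / 2)) g" for i
    proof (rule C1_gradient_Bernstein)
      show "C1_gradient (\<lambda>x. (1 + \<phi> x $ i) / 2) (\<lambda>x. (1/2) *\<^sub>R (0 + G i x))"
        using C1_gradient_cmult[OF C1_gradient_add[OF C1_gradient_const C1[of i]], of "1/2" 1] by simp
    qed
    then show ?thesis
      unfolding \<theta>_def tensor_Bernstein_def by (intro C1_gradient_prod) auto
  qed
  then obtain g where g: "\<And>m. C1_gradient (\<theta> m) (g m)" by metis
  have \<theta>_nonneg: "\<theta> m x \<ge> 0" for m x
    unfolding \<theta>_def using le1[of x]
    by (intro tensor_Bernstein_nonneg) (meson component_le_norm_cart order_trans)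
  have G: "G i x = (\<Sum>m\<in>grid n. ?w m $ i *\<^sub>R g m x)" for i x
  proof -
    have eq: "\<phi> x $ i = (\<Sum>m\<in>grid n. ?w m $ i * \<theta> m x)" for x
      using arg_cong[OF sum_tensor_Bernstein_grid_point[OF n0, of "\<phi> x"], of "\<lambda>v. v $ i"]
      by (simp add: \<theta>_def mult.commute)
    have "((\<lambda>x. \<Sum>m\<in>grid n. ?w m $ i * \<theta> m x) has_derivative (\<lambda>h. \<Sum>m\<in>grid n. ?w m $ i * (g m x \<bullet> h))) (at x)"
      using g unfolding C1_gradient_def
      by (intro has_derivative_sum has_derivative_mult_right) auto
    then have "((\<lambda>x. \<phi> x $ i) has_derivative (\<lambda>h. \<Sum>m\<in>grid n. ?w m $ i * (g m x \<bullet> h))) (at x)"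
      by (simp only: eq)
    moreover have "((\<lambda>x. \<phi> x $ i) has_derivative (\<lambda>h. G i x \<bullet> h)) (at x)"
      using C1[of i] by (auto simp: C1_gradient_def)
    ultimately have "(\<lambda>h. G i x \<bullet> h) = (\<lambda>h. \<Sum>m\<in>grid n. ?w m $ i * (g m x \<bullet> h))"
      by (rule has_derivative_unique[rotated])
    then have "G i x \<bullet> h = (\<Sum>m\<in>grid n. ?w m $ i *\<^sub>R g m x) \<bullet> h" for h
      by (simp add: inner_sum_left fun_eq_iff)
    then show ?thesis by (metis vector_eq_rdot)
  qed
  let ?J = "{m \<in> grid n. ?w m \<noteq> 0}"
  have le: "(\<Sum>m\<in>?J. norm (?w m) / c * \<theta> m x) \<le> 1" for x
  proof -
    have "(\<Sum>m\<in>?J. norm (?w m) / c * \<theta> m x) = (\<Sum>m\<in>grid n. norm (?w m) / c * \<theta> m x)"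
      by (intro sum.mono_neutral_left finite_grid) auto
    also have "\<dots> = (\<Sum>m\<in>grid n. tensor_Bernstein n m (\<phi> x) * norm (?w m)) / c"
      by (simp add: sum_divide_distrib \<theta>_def mult.commute)
    also have "\<dots> \<le> c / c"
      using sum_tensor_Bernstein_norm_grid_point[OF n0 le1[of x]] cn \<open>c > 1\<close>
      by (intro divide_right_mono) auto
    finally show ?thesis using \<open>c > 1\<close> by simp
  qed
  have div: "c * (\<Sum>m\<in>?J. ((norm (?w m) / c) *\<^sub>R g m x) \<bullet> sgn (?w m)) = (\<Sum>i\<in>UNIV. G i x $ i)" for x
  proof -
    have "c * (((norm (?w m) / c) *\<^sub>R g m x) \<bullet> sgn (?w m)) = g m x \<bullet> ?w m" for m
      using \<open>c > 1\<close> by (auto simp: sgn_div_norm field_simps)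
    then have "c * (\<Sum>m\<in>?J. ((norm (?w m) / c) *\<^sub>R g m x) \<bullet> sgn (?w m)) = (\<Sum>m\<in>?J. g m x \<bullet> ?w m)"
      by (simp add: sum_distrib_left del: inner_scaleR_left)
    also have "\<dots> = (\<Sum>m\<in>grid n. g m x \<bullet> ?w m)"
      by (intro sum.mono_neutral_left finite_grid) auto
    also have "\<dots> = (\<Sum>i\<in>UNIV. \<Sum>m\<in>grid n. ?w m $ i * g m x $ i)"
      by (subst sum.swap) (simp add: inner_vec_def mult.commute)
    also have "\<dots> = (\<Sum>i\<in>UNIV. G i x $ i)" by (simp add: G)
    finally show ?thesis .
  qed
  show thesis
  proof (rule that[of ?J "\<lambda>m. sgn (?w m)" "\<lambda>m x. norm (?w m) / c * \<theta> m x"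
        "\<lambda>m x. (norm (?w m) / c) *\<^sub>R g m x"])
    show "finite ?J" by (rule finite_subset[OF _ finite_grid]) auto
    show "norm (sgn (?w m)) = 1" if "m \<in> ?J" for m using that by (simp add: norm_sgn)
    show "C1_gradient (\<lambda>x. norm (?w m) / c * \<theta> m x) (\<lambda>x. (norm (?w m) / c) *\<^sub>R g m x)" for m
      by (intro C1_gradient_cmult g)
    show "norm (?w m) / c * \<theta> m x \<ge> 0" for m x
      using \<theta>_nonneg \<open>c > 1\<close> by simp
  qed (use le div in auto)
qed

section \<open>Extreme points of a random sequence with isotropic law\<close>

text \<open>
  Among \<open>z 0, \<dots>, z n\<close>, the first point at which the inner product with \<open>\<nu>\<close> is maximal.  Breaking ties by
  the index, and not by the position, makes this choice equivariant under isometries.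
\<close>

primrec peak :: "'a::real_inner \<Rightarrow> (nat \<Rightarrow> 'a) \<Rightarrow> nat \<Rightarrow> 'a" where
  "peak \<nu> z 0 = z 0"
| "peak \<nu> z (Suc n) = (if peak \<nu> z n \<bullet> \<nu> < z (Suc n) \<bullet> \<nu> then z (Suc n) else peak \<nu> z n)"

lemma peak_mem: "\<exists>k\<le>n. peak \<nu> z n = z k"
proof (induction n)
  case (Suc n)
  then obtain k where "k \<le> n" "peak \<nu> z n = z k" by blast
  then show ?case by (cases "peak \<nu> z n \<bullet> \<nu> < z (Suc n) \<bullet> \<nu>") (auto intro: exI[of _ k])
qed simp

lemma peak_ge: "k \<le> n \<Longrightarrow> z k \<bullet> \<nu> \<le> peak \<nu> z n \<bullet> \<nu>"
proof (induction n)
  case (Suc n)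
  then show ?case by (cases "k = Suc n") auto
qed simp

lemma peak_isometry:
  assumes "\<And>u v. f u \<bullet> f v = u \<bullet> v"
  shows "peak (f \<nu>) (\<lambda>k. f (z k)) n = f (peak \<nu> z n)"
  by (induction n) (auto simp: assms)

lemma measurable_peak [measurable]:
  fixes \<nu> :: "'a::euclidean_space"
  assumes [measurable]: "\<And>k. Z k \<in> borel_measurable M"
  shows "(\<lambda>\<omega>. peak \<nu> (\<lambda>k. Z k \<omega>) n) \<in> borel_measurable M"
  by (induction n) auto

text \<open>The extreme point, replaced by \<open>0\<close> unless all of \<open>z 0, \<dots>, z n\<close> lie in the ball of radius \<open>\<rho>\<close>.\<close>

definition truncated_peak :: "real \<Rightarrow> nat \<Rightarrow> 'a::real_inner \<Rightarrow> (nat \<Rightarrow> 'a) \<Rightarrow> 'a" where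
  "truncated_peak \<rho> n \<nu> z = (if \<forall>k\<le>n. norm (z k) \<le> \<rho> then peak \<nu> z n else 0)"

lemma norm_truncated_peak_le: "\<rho> \<ge> 0 \<Longrightarrow> norm (truncated_peak \<rho> n \<nu> z) \<le> \<rho>"
  using peak_mem[of n \<nu> z] by (auto simp: truncated_peak_def)

lemma truncated_peak_isometry:
  assumes "linear f" and iso: "\<And>u v. f u \<bullet> f v = u \<bullet> v"
  shows "truncated_peak \<rho> n (f \<nu>) (\<lambda>k. f (z k)) = f (truncated_peak \<rho> n \<nu> z)"
proof -
  have "norm (f u) = norm u" for u by (simp add: norm_eq_sqrt_inner iso)
  then show ?thesis
    using peak_isometry[of f, OF iso, of \<nu> z n] linear_0[OF assms(1)]
    by (auto simp: truncated_peak_def)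
qed

lemma measurable_truncated_peak [measurable]:
  fixes \<nu> :: "'a::euclidean_space"
  assumes [measurable]: "\<And>k. Z k \<in> borel_measurable M"
  shows "(\<lambda>\<omega>. truncated_peak \<rho> n \<nu> (\<lambda>k. Z k \<omega>)) \<in> borel_measurable M"
  unfolding truncated_peak_def by measurable

text \<open>
  A random sequence in \<open>\<real>\<^sup>d\<close> that starts at the origin and whose law, as a law on sequences, is invariant
  under orthogonal maps.
\<close>

locale isotropic_sequence = prob_space M for M :: "'w measure" +
  fixes Z :: "nat \<Rightarrow> 'w \<Rightarrow> real^'n"
  assumes Z_measurable [measurable]: "\<And>k. Z k \<in> borel_measurable M"
    and isotropic_law: "\<And>U :: real^'n^'n. orthogonal_matrix U \<Longrightarrow>
      distr M (\<Pi>\<^sub>M k\<in>UNIV. borel) (\<lambda>\<omega> k. Z k \<omega>) = distr M (\<Pi>\<^sub>M k\<in>UNIV. borel) (\<lambda>\<omega> k. U *v Z k \<omega>)"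
    and Z_start: "AE \<omega> in M. Z 0 \<omega> = 0"
begin

text \<open>The maximum of \<open>Z 0 \<bullet> \<nu>, \<dots>, Z n \<bullet> \<nu>\<close>; for a unit vector \<open>\<nu>\<close> its law does not depend on \<open>\<nu>\<close>.\<close>

definition height :: "nat \<Rightarrow> real^'n \<Rightarrow> 'w \<Rightarrow> real" where
  "height n \<nu> \<omega> = peak \<nu> (\<lambda>k. Z k \<omega>) n \<bullet> \<nu>"

lemma measurable_height [measurable]: "height n \<nu> \<in> borel_measurable M"
  unfolding height_def by measurable

lemma height_nonneg: "AE \<omega> in M. height n \<nu> \<omega> \<ge> 0"
  using Z_start
proof eventually_elim
  case (elim \<omega>)
  then show ?case using peak_ge[of 0 n "\<lambda>k. Z k \<omega>" \<nu>] by (simp add: height_def)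
qed

lemma isotropic_integral:
  fixes F :: "(nat \<Rightarrow> real^'n) \<Rightarrow> 'b::{banach, second_countable_topology}"
  assumes f: "orthogonal_transformation f"
    and [measurable]: "F \<in> borel_measurable (\<Pi>\<^sub>M k\<in>UNIV. borel)"
  shows "(LINT \<omega>|M. F (\<lambda>k. Z k \<omega>)) = (LINT \<omega>|M. F (\<lambda>k. f (Z k \<omega>)))"
proof -
  let ?U = "matrix f"
  have U: "orthogonal_matrix ?U" and lin: "linear f"
    using f orthogonal_transformation_matrix by blast+
  have fU: "f x = ?U *v x" for x using matrix_vector_mul(2)[OF lin] by metis
  have [measurable]: "f \<in> borel_measurable borel"
    using lin by (intro borel_measurable_continuous_onI linear_continuous_on linear_conv_bounded_linear[THEN iffD1])
  have m1: "(\<lambda>\<omega> k. Z k \<omega>) \<in> M \<rightarrow>\<^sub>M (\<Pi>\<^sub>M k\<in>UNIV. borel)"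
    by (rule measurable_PiM_single') auto
  have m2: "(\<lambda>\<omega> k. f (Z k \<omega>)) \<in> M \<rightarrow>\<^sub>M (\<Pi>\<^sub>M k\<in>UNIV. borel)"
    by (rule measurable_PiM_single') auto
  show ?thesis
    using isotropic_law[OF U] integral_distr[OF m1, of F] integral_distr[OF m2, of F]
    by (simp add: fU)
qed

lemma measurable_coordinate_peak:
  fixes \<nu> :: "real^'n"
  shows "(\<lambda>z. peak \<nu> z n) \<in> borel_measurable (\<Pi>\<^sub>M k\<in>UNIV. borel)"
  using measurable_peak[of "\<lambda>k z. z k" "\<Pi>\<^sub>M k\<in>UNIV. borel" \<nu> n] by simp

lemma measurable_coordinate_truncated_peak:
  fixes \<nu> :: "real^'n"
  shows "(\<lambda>z. truncated_peak \<rho> n \<nu> z) \<in> borel_measurable (\<Pi>\<^sub>M k\<in>UNIV. borel)"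
  using measurable_truncated_peak[of "\<lambda>k z. z k" "\<Pi>\<^sub>M k\<in>UNIV. borel" \<rho> n \<nu>] by simp

lemma height_integral_eq:
  fixes F :: "real \<Rightarrow> real"
  assumes "norm \<nu> = 1" "norm \<nu>' = 1" and [measurable]: "F \<in> borel_measurable borel"
  shows "(LINT \<omega>|M. F (height n \<nu> \<omega>)) = (LINT \<omega>|M. F (height n \<nu>' \<omega>))"
proof -
  obtain f where f: "orthogonal_transformation f" "f \<nu>' = \<nu>"
    using orthogonal_transformation_exists[of \<nu>' \<nu>] assms by auto
  have iso: "f u \<bullet> f v = u \<bullet> v" for u v
    using f(1) by (simp add: orthogonal_transformation_def)
  have [measurable]: "(\<lambda>z. F (peak \<nu> z n \<bullet> \<nu>)) \<in> borel_measurable (\<Pi>\<^sub>M k\<in>UNIV. borel)"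
    using measurable_coordinate_peak by measurable
  show ?thesis
    unfolding height_def
    using isotropic_integral[OF f(1), of "\<lambda>z. F (peak \<nu> z n \<bullet> \<nu>)"] peak_isometry[of f \<nu>', OF iso]
    by (simp add: f(2)[symmetric] iso)
qed

lemma prob_height_eq:
  assumes "norm \<nu> = 1" "norm \<nu>' = 1"
  shows "prob {\<omega> \<in> space M. height n \<nu> \<omega> > r} = prob {\<omega> \<in> space M. height n \<nu>' \<omega> > r}"
proof -
  have "(LINT \<omega>|M. indicator {r<..} (height n v \<omega>)) = prob {\<omega> \<in> space M. height n v \<omega> > r}" for v
  proof -
    have "(LINT \<omega>|M. indicator {r<..} (height n v \<omega>) :: real)
        = (LINT \<omega>|M. indicator {\<omega> \<in> space M. height n v \<omega> > r} \<omega>)"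
      by (intro Bochner_Integration.integral_cong) (auto simp: indicator_def)
    then show ?thesis by simp
  qed
  then show ?thesis using height_integral_eq[OF assms, of "indicator {r<..}" n] by simp
qed

lemma truncated_peak_integrable: "\<rho> \<ge> 0 \<Longrightarrow> integrable M (\<lambda>\<omega>. truncated_peak \<rho> n \<nu> (\<lambda>k. Z k \<omega>))"
  by (rule integrable_const_bound[of _ \<rho>]) (auto simp: norm_truncated_peak_le)

lemma truncated_height_integrable: "integrable M (\<lambda>\<omega>. min (height n \<nu> \<omega>) 1)"
  by (rule integrable_const_bound[of _ 1]) (use height_nonneg[of n \<nu>] in \<open>auto elim!: eventually_mono\<close>)

text \<open>
  The orthogonal map \<open>f\<close> that fixes \<open>\<nu>\<close> and is \<open>- id\<close> on its orthogonal complement preserves the law of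
  the sequence and commutes with taking the extreme point in direction \<open>\<nu>\<close>; so the mean of that point
  is a fixed vector of \<open>f\<close>.
\<close>

lemma truncated_peak_mean_parallel:
  assumes "norm \<nu> = 1" "\<rho> \<ge> 0"
  shows "(LINT \<omega>|M. truncated_peak \<rho> n \<nu> (\<lambda>k. Z k \<omega>))
       = (LINT \<omega>|M. truncated_peak \<rho> n \<nu> (\<lambda>k. Z k \<omega>) \<bullet> \<nu>) *\<^sub>R \<nu>" (is "?m = _")
proof -
  define f where "f u = (2 * (u \<bullet> \<nu>)) *\<^sub>R \<nu> - u" for u
  have \<nu>: "\<nu> \<bullet> \<nu> = 1" using assms(1) by (simp add: norm_eq_1)
  have lin: "linear f"
    unfolding f_def by (intro linearI) (auto simp: algebra_simps inner_add_left)
  have iso: "f u \<bullet> f v = u \<bullet> v" for u v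
    by (simp add: f_def inner_diff_left inner_diff_right \<nu> inner_commute)
  have f: "orthogonal_transformation f"
    using lin iso by (simp add: orthogonal_transformation_def)
  have f\<nu>: "f \<nu> = \<nu>" by (simp add: f_def \<nu> scaleR_2)
  let ?Y = "\<lambda>\<omega>. truncated_peak \<rho> n \<nu> (\<lambda>k. Z k \<omega>)"
  have int: "integrable M ?Y" by (rule truncated_peak_integrable[OF assms(2)])
  have "?m = (LINT \<omega>|M. f (?Y \<omega>))"
    using isotropic_integral[OF f measurable_coordinate_truncated_peak, of \<rho> n \<nu>]
      truncated_peak_isometry[OF lin iso, of \<rho> n \<nu>]
    by (simp add: f\<nu>)
  also have "\<dots> = f ?m"
    using int lin by (intro integral_bounded_linear linear_conv_bounded_linear[THEN iffD1])
  finally have "2 *\<^sub>R ?m = 2 *\<^sub>R ((?m \<bullet> \<nu>) *\<^sub>R \<nu>)"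
    by (simp add: f_def scaleR_2)
  then have "?m = (?m \<bullet> \<nu>) *\<^sub>R \<nu>" by (simp only: scaleR_cancel_left) simp
  also have "?m \<bullet> \<nu> = (LINT \<omega>|M. ?Y \<omega> \<bullet> \<nu>)" using int by simp
  finally show ?thesis .
qed

text \<open>The event that one of \<open>Z 0, \<dots>, Z n\<close> lies outside the closed ball of radius \<open>\<rho>\<close>.\<close>

definition escape :: "real \<Rightarrow> nat \<Rightarrow> 'w set" where
  "escape \<rho> n = {\<omega> \<in> space M. \<exists>k\<le>n. norm (Z k \<omega>) > \<rho>}"

lemma escape_sets [measurable]: "escape \<rho> n \<in> sets M"
  unfolding escape_def by measurable

lemma truncated_peak_mean_height:
  assumes "norm \<nu> = 1" "0 \<le> \<rho>" "\<rho> \<le> 1"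
  shows "\<bar>(LINT \<omega>|M. truncated_peak \<rho> n \<nu> (\<lambda>k. Z k \<omega>) \<bullet> \<nu>) - (LINT \<omega>|M. min (height n \<nu> \<omega>) 1)\<bar>
       \<le> prob (escape \<rho> n)"
proof -
  let ?Y = "\<lambda>\<omega>. truncated_peak \<rho> n \<nu> (\<lambda>k. Z k \<omega>)"
  let ?h = "\<lambda>\<omega>. min (height n \<nu> \<omega>) 1"
  have int: "integrable M (\<lambda>\<omega>. ?Y \<omega> \<bullet> \<nu>)" "integrable M ?h"
    using truncated_peak_integrable[OF assms(2)] truncated_height_integrable by auto
  have "AE \<omega> in M. \<bar>?Y \<omega> \<bullet> \<nu> - ?h \<omega>\<bar> \<le> indicator (escape \<rho> n) \<omega>"
    using height_nonneg[of n \<nu>] AE_space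
  proof eventually_elim
    case (elim \<omega>)
    show ?case
    proof (cases "\<omega> \<in> escape \<rho> n")
      case True
      then have "?Y \<omega> = 0" by (auto simp: escape_def truncated_peak_def not_le)
      then show ?thesis using True elim by (simp add: min_def)
    next
      case False
      then have "\<forall>k\<le>n. norm (Z k \<omega>) \<le> \<rho>" using elim by (auto simp: escape_def not_less)
      then have Y: "?Y \<omega> = peak \<nu> (\<lambda>k. Z k \<omega>) n" by (simp add: truncated_peak_def)
      have "height n \<nu> \<omega> \<le> norm (?Y \<omega>) * norm \<nu>"
        unfolding Y height_def by (rule norm_cauchy_schwarz)
      also have "\<dots> \<le> 1" using norm_truncated_peak_le[OF assms(2), of n \<nu>] assms order_trans by auto
      finally show ?thesis using False Y by (simp add: height_def)
    qed
  qed
  then have "(LINT \<omega>|M. \<bar>?Y \<omega> \<bullet> \<nu> - ?h \<omega>\<bar>) \<le> (LINT \<omega>|M. indicator (escape \<rho> n) \<omega>)"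
    using int by (intro integral_mono_AE) (auto simp: emeasure_eq_measure)
  moreover have "\<bar>LINT \<omega>|M. ?Y \<omega> \<bullet> \<nu> - ?h \<omega>\<bar> \<le> (LINT \<omega>|M. \<bar>?Y \<omega> \<bullet> \<nu> - ?h \<omega>\<bar>)"
    by (rule integral_abs_bound)
  ultimately show ?thesis using int by simp
qed

text \<open>
  A vector longer than \<open>\<rho>\<close> has a coordinate larger than \<open>\<rho> / d\<close> in absolute value; a union bound over the
  \<open>2 d\<close> signed coordinate directions gives the estimate.
\<close>

lemma prob_escape_le:
  assumes "norm \<nu> = 1"
  shows "prob (escape \<rho> n) \<le> 2 * CARD('n) * prob {\<omega> \<in> space M. height n \<nu> \<omega> > \<rho> / CARD('n)}"
proof -
  let ?d = "real CARD('n)"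
  let ?B = "\<lambda>v. {\<omega> \<in> space M. height n v \<omega> > \<rho> / ?d}"
  have "escape \<rho> n \<subseteq> (\<Union>i\<in>UNIV. ?B (axis i 1) \<union> ?B (- axis i 1))"
  proof
    fix \<omega> assume "\<omega> \<in> escape \<rho> n"
    then obtain k where k: "k \<le> n" "norm (Z k \<omega>) > \<rho>" and \<omega>: "\<omega> \<in> space M" by (auto simp: escape_def)
    have "\<exists>i. \<bar>Z k \<omega> $ i\<bar> > \<rho> / ?d"
    proof (rule ccontr)
      assume "\<not> ?thesis"
      then have "(\<Sum>i\<in>UNIV. \<bar>Z k \<omega> $ i\<bar>) \<le> (\<Sum>i\<in>(UNIV::'n set). \<rho> / ?d)"
        by (intro sum_mono) (auto simp: not_less)
      then show False using norm_le_l1_cart[of "Z k \<omega>"] k(2) by simp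
    qed
    then obtain i where "Z k \<omega> \<bullet> axis i 1 > \<rho> / ?d \<or> Z k \<omega> \<bullet> (- axis i 1) > \<rho> / ?d"
      by (auto simp: inner_axis abs_real_def split: if_splits)
    then have "height n (axis i 1) \<omega> > \<rho> / ?d \<or> height n (- axis i 1) \<omega> > \<rho> / ?d"
      unfolding height_def using peak_ge[OF k(1), of "\<lambda>k. Z k \<omega>"] less_le_trans by blast
    then show "\<omega> \<in> (\<Union>i\<in>UNIV. ?B (axis i 1) \<union> ?B (- axis i 1))" using \<omega> by auto
  qed
  then have "prob (escape \<rho> n) \<le> prob (\<Union>i\<in>UNIV. ?B (axis i 1) \<union> ?B (- axis i 1))"
    by (intro finite_measure_mono) auto
  also have "\<dots> \<le> (\<Sum>i\<in>UNIV. prob (?B (axis i 1) \<union> ?B (- axis i 1)))"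
    by (intro finite_measure_subadditive_finite) auto
  also have "\<dots> \<le> (\<Sum>i\<in>(UNIV::'n set). 2 * prob (?B \<nu>))"
  proof (rule sum_mono)
    fix i :: 'n
    have "prob (?B (axis i 1) \<union> ?B (- axis i 1)) \<le> prob (?B (axis i 1)) + prob (?B (- axis i 1))"
      by (intro measure_Un_le) auto
    also have "\<dots> = 2 * prob (?B \<nu>)"
      using prob_height_eq[OF _ assms, of "axis i 1"] prob_height_eq[OF _ assms, of "- axis i 1"]
      by (simp add: norm_axis_1)
    finally show "prob (?B (axis i 1) \<union> ?B (- axis i 1)) \<le> 2 * prob (?B \<nu>)" .
  qed
  finally show ?thesis by simp
qed

text \<open>The norm is bounded by the sum of the heights in the \<open>2 d\<close> signed coordinate directions.\<close>

lemma truncated_peak_mean_norm: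
  assumes "norm \<nu> = 1" "norm \<nu>' = 1" "0 \<le> \<rho>" "\<rho> \<le> 1"
  shows "(LINT \<omega>|M. norm (truncated_peak \<rho> n \<nu>' (\<lambda>k. Z k \<omega>)))
       \<le> 2 * CARD('n) * (LINT \<omega>|M. min (height n \<nu> \<omega>) 1)"
proof -
  let ?Y = "\<lambda>\<omega>. truncated_peak \<rho> n \<nu>' (\<lambda>k. Z k \<omega>)"
  let ?h = "\<lambda>v \<omega>. min (height n v \<omega>) 1"
  let ?S = "\<lambda>\<omega>. \<Sum>i\<in>UNIV. ?h (axis i 1) \<omega> + ?h (- axis i 1) \<omega>"
  have "AE \<omega> in M. \<forall>i\<in>UNIV. height n (axis i 1) \<omega> \<ge> 0 \<and> height n (- axis i 1) \<omega> \<ge> 0"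
    using height_nonneg by (intro AE_finite_allI) (auto intro: AE_conjI)
  then have "AE \<omega> in M. norm (?Y \<omega>) \<le> ?S \<omega>"
  proof eventually_elim
    case (elim \<omega>)
    show ?case
    proof (cases "\<forall>k\<le>n. norm (Z k \<omega>) \<le> \<rho>")
      case True
      obtain k where k: "k \<le> n" "?Y \<omega> = Z k \<omega>"
        using True peak_mem[of n \<nu>' "\<lambda>k. Z k \<omega>"] by (auto simp: truncated_peak_def)
      have le: "\<bar>Z k \<omega> $ i\<bar> \<le> ?h (axis i 1) \<omega> + ?h (- axis i 1) \<omega>" for i
      proof -
        have "\<bar>Z k \<omega> $ i\<bar> \<le> 1"
          using component_le_norm_cart[of "Z k \<omega>" i] True k(1) assms(4) by (meson order_trans)
        moreover have "Z k \<omega> $ i \<le> height n (axis i 1) \<omega>" "- Z k \<omega> $ i \<le> height n (- axis i 1) \<omega>"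
          unfolding height_def
          using peak_ge[OF k(1), of "\<lambda>k. Z k \<omega>" "axis i 1"] peak_ge[OF k(1), of "\<lambda>k. Z k \<omega>" "- axis i 1"]
          by (simp_all add: inner_axis)
        moreover have "height n (axis i 1) \<omega> \<ge> 0" "height n (- axis i 1) \<omega> \<ge> 0" using elim by auto
        ultimately show ?thesis by linarith
      qed
      have "norm (?Y \<omega>) \<le> (\<Sum>i\<in>UNIV. \<bar>Z k \<omega> $ i\<bar>)"
        unfolding k(2) by (rule norm_le_l1_cart)
      also have "\<dots> \<le> ?S \<omega>" by (intro sum_mono le)
      finally show ?thesis .
    next
      case False
      then have "?Y \<omega> = 0" by (simp only: truncated_peak_def if_False)
      then show ?thesis using elim by (auto intro!: sum_nonneg)
    qed
  qed
  then have "(LINT \<omega>|M. norm (?Y \<omega>)) \<le> (LINT \<omega>|M. ?S \<omega>)"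
    using truncated_peak_integrable[OF assms(3)] truncated_height_integrable
    by (intro integral_mono_AE) auto
  also have "\<dots> = (\<Sum>i\<in>UNIV. (LINT \<omega>|M. ?h (axis i 1) \<omega>) + (LINT \<omega>|M. ?h (- axis i 1) \<omega>))"
    using truncated_height_integrable by (simp add: Bochner_Integration.integral_sum)
  also have "\<dots> = (\<Sum>i\<in>(UNIV::'n set). 2 * (LINT \<omega>|M. ?h \<nu> \<omega>))"
    using height_integral_eq[OF _ assms(1), of "axis i 1" "\<lambda>x. min x 1" for i]
      height_integral_eq[OF _ assms(1), of "- axis i 1" "\<lambda>x. min x 1" for i]
    by (intro sum.cong) (simp_all add: norm_axis_1)
  finally show ?thesis by simp
qed

end

section \<open>Volume swept out by a random sequence\<close>

lemma set_integrable_continuous_bounded: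
  fixes f :: "'a::euclidean_space \<Rightarrow> 'b::{banach, second_countable_topology}"
  assumes "continuous_on UNIV f" "bounded D" "D \<in> sets borel"
  shows "set_integrable lborel D f"
proof (rule set_integrable_subset)
  show "set_integrable lborel (closure D) f"
    unfolding set_integrable_def using assms
    by (intro borel_integrable_compact) (auto intro: continuous_on_subset)
qed (use assms in \<open>auto simp: closure_subset\<close>)

lemma set_lebesgue_integral_translate:
  fixes f :: "'a::euclidean_space \<Rightarrow> real"
  assumes [measurable]: "f \<in> borel_measurable borel" "D \<in> sets borel"
  shows "(LINT x:D|lborel. f (x - y)) = (LINT x|lborel. indicator D (x + y) * f x)"
    and "set_integrable lborel D (\<lambda>x. f (x - y)) \<Longrightarrow> integrable lborel (\<lambda>x. indicator D (x + y) * f x)"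
proof -
  let ?h = "\<lambda>x. indicator D x * f (x - y)"
  have d: "distr lborel borel ((+) y) = (lborel :: 'a measure)" by (rule lborel_distr_plus)
  have "(LINT x|lborel. ?h x) = (LINT x|distr lborel borel ((+) y). ?h x)" by (simp only: d)
  also have "\<dots> = (LINT x|lborel. ?h (y + x))" by (rule integral_distr) measurable
  finally show "(LINT x:D|lborel. f (x - y)) = (LINT x|lborel. indicator D (x + y) * f x)"
    by (simp add: set_lebesgue_integral_def add.commute)
  assume "set_integrable lborel D (\<lambda>x. f (x - y))"
  then have "integrable (distr lborel borel ((+) y)) ?h" by (simp only: d) (simp add: set_integrable_def)
  then have "integrable lborel (\<lambda>x. ?h (y + x))" by (subst (asm) integrable_distr_eq) auto
  then show "integrable lborel (\<lambda>x. indicator D (x + y) * f x)" by (simp add: add.commute)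
qed

text \<open>
  The indicator of the exit set dominates \<open>\<Sum>j. (1\<^sub>D x - 1\<^sub>D (x + y j)) * \<psi> j x\<close>: for \<open>x \<notin> D\<close> the summands
  are not positive, and for \<open>x \<in> D\<close> outside the exit set they vanish.
\<close>

lemma exit_volume_lower_bound:
  fixes D :: "'a::euclidean_space set"
  assumes D: "open D" "bounded D" and "finite J"
    and cont: "\<And>j. j \<in> J \<Longrightarrow> continuous_on UNIV (\<psi> j)"
    and nonneg: "\<And>j x. j \<in> J \<Longrightarrow> \<psi> j x \<ge> 0"
    and le1: "\<And>x. (\<Sum>j\<in>J. \<psi> j x) \<le> 1"
    and y: "\<And>j. j \<in> J \<Longrightarrow> y j = 0 \<or> (\<exists>k\<le>n. y j = z k)"
  shows "(\<Sum>j\<in>J. LINT x:D|lborel. \<psi> j x - \<psi> j (x - y j))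
       \<le> measure lborel {x \<in> D. \<exists>k\<le>(n::nat). x + z k \<notin> D}"
proof -
  have D_sets [measurable]: "D \<in> sets borel" using D(1) by simp
  let ?A = "{x \<in> D. \<exists>k\<le>n. x + z k \<notin> D}"
  have A_sets [measurable]: "?A \<in> sets borel" by measurable
  have "emeasure lborel D < \<infinity>" using emeasure_bounded_finite[OF D(2)] .
  then have finA: "emeasure lborel ?A < \<infinity>"
    by (rule le_less_trans[rotated]) (auto intro!: emeasure_mono)
  have m: "\<psi> j \<in> borel_measurable borel" if "j \<in> J" for j
    using cont[OF that] by (rule borel_measurable_continuous_onI)
  have c': "continuous_on UNIV (\<lambda>x. \<psi> j (x - y j))" if "j \<in> J" for j
    using cont[OF that] by (rule continuous_on_compose2) (auto intro: continuous_intros)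
  have i1: "integrable lborel (\<lambda>x. indicator D x * \<psi> j x)" if "j \<in> J" for j
    using set_integrable_continuous_bounded[OF cont[OF that] D(2) D_sets]
    by (simp add: set_integrable_def)
  have i2: "integrable lborel (\<lambda>x. indicator D (x + y j) * \<psi> j x)" if "j \<in> J" for j
    using set_integrable_continuous_bounded[OF c'[OF that] D(2) D_sets]
    by (rule set_lebesgue_integral_translate(2)[OF m[OF that] D_sets])
  have "(LINT x:D|lborel. \<psi> j x - \<psi> j (x - y j))
      = (LINT x|lborel. (indicator D x - indicator D (x + y j)) * \<psi> j x)" if "j \<in> J" for j
  proof -
    have "(LINT x:D|lborel. \<psi> j x - \<psi> j (x - y j)) = (LINT x:D|lborel. \<psi> j x) - (LINT x:D|lborel. \<psi> j (x - y j))"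
      using set_integrable_continuous_bounded[OF cont[OF that] D(2) D_sets]
        set_integrable_continuous_bounded[OF c'[OF that] D(2) D_sets]
      by (rule set_integral_diff)
    also have "\<dots> = (LINT x|lborel. indicator D x * \<psi> j x) - (LINT x|lborel. indicator D (x + y j) * \<psi> j x)"
      using set_lebesgue_integral_translate(1)[OF m[OF that] D_sets, of "y j"]
      by (simp add: set_lebesgue_integral_def)
    also have "\<dots> = (LINT x|lborel. (indicator D x - indicator D (x + y j)) * \<psi> j x)"
      using i1[OF that] i2[OF that] by (simp add: left_diff_distrib)
    finally show ?thesis .
  qed
  then have "(\<Sum>j\<in>J. LINT x:D|lborel. \<psi> j x - \<psi> j (x - y j))
      = (\<Sum>j\<in>J. (LINT x|lborel. (indicator D x - indicator D (x + y j)) * \<psi> j x))"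
    by (intro sum.cong) auto
  also have "\<dots> = (LINT x|lborel. (\<Sum>j\<in>J. (indicator D x - indicator D (x + y j)) * \<psi> j x))"
    using i1 i2 by (intro Bochner_Integration.integral_sum[symmetric]) (simp add: left_diff_distrib)
  also have "\<dots> \<le> (LINT x|lborel. indicator ?A x)"
  proof (rule integral_mono)
    show "integrable lborel (\<lambda>x. \<Sum>j\<in>J. (indicator D x - indicator D (x + y j)) * \<psi> j x)"
      using i1 i2 by (intro Bochner_Integration.integrable_sum) (simp add: left_diff_distrib)
    show "integrable lborel (indicator ?A :: 'a \<Rightarrow> real)"
      using finA by (intro integrable_real_indicator) auto
    fix x
    have "(\<Sum>j\<in>J. (indicator D x - indicator D (x + y j)) * \<psi> j x) \<le> (\<Sum>j\<in>J. indicator ?A x * \<psi> j x)"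
    proof (intro sum_mono mult_right_mono nonneg)
      fix j assume "j \<in> J"
      show "indicator D x - indicator D (x + y j) \<le> (indicator ?A x :: real)"
        using y[OF \<open>j \<in> J\<close>] by (auto simp: indicator_def)
    qed
    also have "\<dots> = indicator ?A x * (\<Sum>j\<in>J. \<psi> j x)" by (simp add: sum_distrib_left)
    also have "\<dots> \<le> indicator ?A x * 1" by (intro mult_left_mono le1) auto
    finally show "(\<Sum>j\<in>J. (indicator D x - indicator D (x + y j)) * \<psi> j x) \<le> indicator ?A x" by simp
  qed
  finally show ?thesis by simp
qed

context isotropic_sequence
begin

lemma measurable_stay_probability:
  assumes [measurable]: "D \<in> sets borel"
  shows "(\<lambda>x. prob {\<omega> \<in> space M. \<forall>k\<le>n. x + Z k \<omega> \<in> D}) \<in> borel_measurable borel"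
proof -
  have "(\<lambda>x. emeasure M {\<omega> \<in> space M. \<forall>k\<le>n. x + Z k \<omega> \<in> D}) \<in> borel_measurable borel"
    by measurable
  then show ?thesis unfolding measure_def by measurable
qed

lemma stay_probability_integrable:
  assumes D: "open D" "bounded D"
  shows "set_integrable lborel D (\<lambda>x. prob {\<omega> \<in> space M. \<forall>k\<le>n. x + Z k \<omega> \<in> D})"
proof -
  have D_sets [measurable]: "D \<in> sets borel" using D(1) by simp
  have finD: "emeasure lborel D < \<infinity>" using emeasure_bounded_finite[OF D(2)] .
  show ?thesis
    unfolding set_integrable_def
  proof (rule Bochner_Integration.integrable_bound)
    show "integrable lborel (indicator D :: _ \<Rightarrow> real)"
      using finD by (intro integrable_real_indicator) auto
    show "AE x in lborel. norm (indicator D x *\<^sub>R prob {\<omega> \<in> space M. \<forall>k\<le>n. x + Z k \<omega> \<in> D})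
        \<le> norm (indicator D x :: real)"
      by (intro AE_I2) (auto simp: indicator_def)
    show "(\<lambda>x. indicator D x *\<^sub>R prob {\<omega> \<in> space M. \<forall>k\<le>n. x + Z k \<omega> \<in> D}) \<in> borel_measurable lborel"
      using measurable_stay_probability[OF D_sets, of n] by simp
  qed
qed

text \<open>Fubini: the expected exit volume in terms of the probabilities to stay in \<open>D\<close>.\<close>

lemma expected_exit_volume:
  assumes D: "open D" "bounded D"
  shows "(LINT \<omega>|M. measure lborel {x \<in> D. \<exists>k\<le>n. x + Z k \<omega> \<notin> D})
       = measure lborel D - (LINT x:D|lborel. prob {\<omega> \<in> space M. \<forall>k\<le>n. x + Z k \<omega> \<in> D})"
    and "integrable M (\<lambda>\<omega>. measure lborel {x \<in> D. \<exists>k\<le>n. x + Z k \<omega> \<notin> D})"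
proof -
  have D_sets [measurable]: "D \<in> sets borel" using D(1) by simp
  have finD: "emeasure lborel D < \<infinity>" using emeasure_bounded_finite[OF D(2)] .
  note emeasure_Times = emeasure_pair_measure_Times
  interpret pair_sigma_finite "lborel :: (real^'n) measure" M
    by (intro pair_sigma_finite.intro sigma_finite_lborel sigma_finite_measure_axioms)
  let ?q = "\<lambda>x \<omega>. of_bool (x \<in> D \<and> (\<exists>k\<le>n. x + Z k \<omega> \<notin> D)) :: real"
  let ?s = "\<lambda>x. prob {\<omega> \<in> space M. \<forall>k\<le>n. x + Z k \<omega> \<in> D}"
  have "emeasure (lborel \<Otimes>\<^sub>M M) (D \<times> space M) = emeasure lborel D * emeasure M (space M)"
    by (rule emeasure_Times) auto
  then have i0: "integrable (lborel \<Otimes>\<^sub>M M) (indicator (D \<times> space M) :: _ \<Rightarrow> real)"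
    using finD by (intro integrable_real_indicator) (auto simp: emeasure_space_1)
  have int: "integrable (lborel \<Otimes>\<^sub>M M) (case_prod ?q)"
  proof (rule Bochner_Integration.integrable_bound[OF i0])
    show "case_prod ?q \<in> borel_measurable (lborel \<Otimes>\<^sub>M M)" by measurable
    show "AE p in lborel \<Otimes>\<^sub>M M. norm (case_prod ?q p) \<le> norm (indicator (D \<times> space M) p :: real)"
      by (intro AE_I2) (auto simp: space_pair_measure indicator_def)
  qed
  have inner_x: "(LINT x|lborel. ?q x \<omega>) = measure lborel {x \<in> D. \<exists>k\<le>n. x + Z k \<omega> \<notin> D}" for \<omega>
  proof -
    have "(\<lambda>x. ?q x \<omega>) = indicator {x \<in> D. \<exists>k\<le>n. x + Z k \<omega> \<notin> D}"
      by (auto simp: indicator_def fun_eq_iff)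
    then show ?thesis by simp
  qed
  have inner_\<omega>: "(LINT \<omega>|M. ?q x \<omega>) = indicator D x * (1 - ?s x)" for x
  proof -
    have "(LINT \<omega>|M. ?q x \<omega>)
        = (LINT \<omega>|M. indicator D x * (1 - indicator {\<omega> \<in> space M. \<forall>k\<le>n. x + Z k \<omega> \<in> D} \<omega>))"
      by (intro Bochner_Integration.integral_cong) (auto simp: indicator_def)
    then show ?thesis by (simp add: prob_space emeasure_eq_measure)
  qed
  show "integrable M (\<lambda>\<omega>. measure lborel {x \<in> D. \<exists>k\<le>n. x + Z k \<omega> \<notin> D})"
    using integrable_snd[OF int] by (simp only: inner_x)
  have s: "set_integrable lborel D ?s" by (rule stay_probability_integrable[OF D])
  have "(LINT \<omega>|M. measure lborel {x \<in> D. \<exists>k\<le>n. x + Z k \<omega> \<notin> D}) = (LINT x|lborel. indicator D x * (1 - ?s x))"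
    using Fubini_integral[OF int] by (simp only: inner_x inner_\<omega>)
  also have "\<dots> = (LINT x|lborel. indicator D x) - (LINT x:D|lborel. ?s x)"
    unfolding set_lebesgue_integral_def
  proof (subst Bochner_Integration.integral_diff[symmetric])
    show "integrable lborel (indicator D :: _ \<Rightarrow> real)"
      using finD by (intro integrable_real_indicator) auto
  qed (use s in \<open>simp_all add: set_integrable_def right_diff_distrib\<close>)
  finally show "(LINT \<omega>|M. measure lborel {x \<in> D. \<exists>k\<le>n. x + Z k \<omega> \<notin> D})
       = measure lborel D - (LINT x:D|lborel. ?s x)" by simp
qed

text \<open>
  The mean of \<open>exit_volume_lower_bound\<close>, with the truncated extreme point in direction \<open>\<nu> j\<close> as \<open>y j\<close>.
  The first error term comes from the truncation, the second one from the first-order expansion.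
\<close>

lemma exit_volume_mean_lower_bound:
  fixes \<nu> :: "'j \<Rightarrow> real^'n"
    and \<rho> \<eta> a p :: real and G :: "'j \<Rightarrow> real" and n :: nat and e :: "real^'n"
  assumes D: "open D" "bounded D" and "finite J"
    and C1: "\<And>j. j \<in> J \<Longrightarrow> C1_gradient (\<psi> j) (g j)"
    and nonneg: "\<And>j x. j \<in> J \<Longrightarrow> \<psi> j x \<ge> 0"
    and le1: "\<And>x. (\<Sum>j\<in>J. \<psi> j x) \<le> 1"
    and unit: "\<And>j. j \<in> J \<Longrightarrow> norm (\<nu> j) = 1" "norm e = 1"
    and taylor: "\<And>j x y. j \<in> J \<Longrightarrow> x \<in> D \<Longrightarrow> norm y \<le> \<rho> \<Longrightarrow>
        \<bar>\<psi> j x - \<psi> j (x - y) - g j x \<bullet> y\<bar> \<le> \<eta> * norm y"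
    and \<rho>: "0 \<le> \<rho>" "\<rho> \<le> 1" and \<eta>: "\<eta> \<ge> 0"
  defines "a \<equiv> LINT \<omega>|M. min (height n e \<omega>) 1"
    and "p \<equiv> prob {\<omega> \<in> space M. height n e \<omega> > \<rho> / CARD('n)}"
    and "G \<equiv> \<lambda>j. LINT x:D|lborel. g j x \<bullet> \<nu> j"
  shows "a * (\<Sum>j\<in>J. G j) - 2 * real CARD('n) * p * (\<Sum>j\<in>J. \<bar>G j\<bar>)
           - 2 * real CARD('n) * real (card J) * \<eta> * measure lborel D * a
       \<le> measure lborel D - (LINT x:D|lborel. prob {\<omega> \<in> space M. \<forall>k\<le>n. x + Z k \<omega> \<in> D})"
proof -
  have D_sets [measurable]: "D \<in> sets borel" using D(1) by simp
  have finD: "emeasure lborel D < \<infinity>" using emeasure_bounded_finite[OF D(2)] .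
  let ?V = "measure lborel D"
  let ?d = "real CARD('n)"
  let ?Y = "\<lambda>j \<omega>. truncated_peak \<rho> n (\<nu> j) (\<lambda>k. Z k \<omega>)"
  define H where "H j = (LINT x:D|lborel. g j x)" for j
  have g_int: "set_integrable lborel D (g j)" if "j \<in> J" for j
    using C1_gradient_continuous(2)[OF C1[OF that]] D by (intro set_integrable_continuous_bounded) auto
  have H: "(LINT x:D|lborel. g j x \<bullet> v) = H j \<bullet> v" if "j \<in> J" for j v
    using integral_inner_left[of v lborel "\<lambda>x. indicator D x *\<^sub>R g j x"] g_int[OF that]
    by (simp add: H_def set_lebesgue_integral_def set_integrable_def)
  have pathwise: "H j \<bullet> y - \<eta> * ?V * norm y \<le> (LINT x:D|lborel. \<psi> j x - \<psi> j (x - y))"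
    if j: "j \<in> J" and y: "norm y \<le> \<rho>" for j y
  proof -
    have gy: "set_integrable lborel D (\<lambda>x. g j x \<bullet> y)"
      using C1_gradient_continuous(2)[OF C1[OF j]] D
      by (intro set_integrable_continuous_bounded continuous_intros) auto
    have cy: "set_integrable lborel D (\<lambda>x. \<eta> * norm y)"
      using D by (intro set_integrable_continuous_bounded continuous_intros) auto
    have "H j \<bullet> y - \<eta> * ?V * norm y = (LINT x:D|lborel. g j x \<bullet> y) - (LINT x:D|lborel. \<eta> * norm y)"
    proof -
      have "(LINT x:D|lborel. \<eta> * norm y) = ?V * (\<eta> * norm y)"
        by (simp add: set_lebesgue_integral_def)
      then show ?thesis by (simp only: H[OF j] mult_ac)
    qed
    also have "\<dots> = (LINT x:D|lborel. g j x \<bullet> y - \<eta> * norm y)"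
      by (rule set_integral_diff(2)[OF gy cy, symmetric])
    also have "\<dots> \<le> (LINT x:D|lborel. \<psi> j x - \<psi> j (x - y))"
    proof (rule set_integral_mono)
      show "set_integrable lborel D (\<lambda>x. g j x \<bullet> y - \<eta> * norm y)"
        by (rule set_integral_diff(1)[OF gy cy])
      show "set_integrable lborel D (\<lambda>x. \<psi> j x - \<psi> j (x - y))"
        using C1_gradient_continuous(1)[OF C1[OF j]] D
        by (intro set_integrable_continuous_bounded continuous_intros)
          (auto intro!: continuous_on_compose2[of UNIV "\<psi> j"] continuous_intros)
      show "g j x \<bullet> y - \<eta> * norm y \<le> \<psi> j x - \<psi> j (x - y)" if "x \<in> D" for x
        using taylor[OF j that y] by linarith
    qed
    finally show ?thesis .
  qed
  have Y_int: "integrable M (?Y j)" for j by (rule truncated_peak_integrable[OF \<rho>(1)])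
  define m where "m j = (LINT \<omega>|M. ?Y j \<omega> \<bullet> \<nu> j)" for j
  have mean: "(LINT \<omega>|M. H j \<bullet> ?Y j \<omega>) = m j * G j" if j: "j \<in> J" for j
  proof -
    have "(LINT \<omega>|M. H j \<bullet> ?Y j \<omega>) = H j \<bullet> (LINT \<omega>|M. ?Y j \<omega>)"
      using Y_int[of j] by simp
    also have "\<dots> = H j \<bullet> (m j *\<^sub>R \<nu> j)"
      unfolding m_def using truncated_peak_mean_parallel[OF unit(1)[OF j] \<rho>(1), of n] by simp
    finally show ?thesis by (simp add: G_def H[OF j])
  qed
  have m: "\<bar>m j - a\<bar> \<le> 2 * ?d * p" if j: "j \<in> J" for j
  proof -
    have "a = (LINT \<omega>|M. min (height n (\<nu> j) \<omega>) 1)"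
      unfolding a_def using unit j by (intro height_integral_eq) auto
    then have "\<bar>m j - a\<bar> \<le> prob (escape \<rho> n)"
      unfolding m_def using truncated_peak_mean_height[OF unit(1)[OF j] \<rho>] by simp
    also have "\<dots> \<le> 2 * ?d * p" unfolding p_def using prob_escape_le[OF unit(2)] by simp
    finally show ?thesis .
  qed
  have summand: "a * G j - 2 * ?d * p * \<bar>G j\<bar> - \<eta> * ?V * (2 * ?d * a)
      \<le> (LINT \<omega>|M. H j \<bullet> ?Y j \<omega> - \<eta> * ?V * norm (?Y j \<omega>))" if j: "j \<in> J" for j
  proof -
    have "a * G j - m j * G j \<le> \<bar>m j - a\<bar> * \<bar>G j\<bar>"
      by (metis abs_ge_self abs_minus_commute abs_mult left_diff_distrib)
    also have "\<dots> \<le> 2 * ?d * p * \<bar>G j\<bar>" using m[OF j] by (intro mult_right_mono) auto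
    finally have 1: "a * G j - 2 * ?d * p * \<bar>G j\<bar> \<le> m j * G j" by simp
    have 2: "\<eta> * ?V * (LINT \<omega>|M. norm (?Y j \<omega>)) \<le> \<eta> * ?V * (2 * ?d * a)"
      unfolding a_def using \<eta> truncated_peak_mean_norm[OF unit(2) unit(1)[OF j] \<rho>]
      by (intro mult_left_mono) auto
    have "(LINT \<omega>|M. H j \<bullet> ?Y j \<omega> - \<eta> * ?V * norm (?Y j \<omega>))
        = (LINT \<omega>|M. H j \<bullet> ?Y j \<omega>) - (LINT \<omega>|M. \<eta> * ?V * norm (?Y j \<omega>))"
      using Y_int[of j] by (intro Bochner_Integration.integral_diff) auto
    also have "\<dots> = m j * G j - \<eta> * ?V * (LINT \<omega>|M. norm (?Y j \<omega>))"
      by (simp add: mean[OF j])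
    finally show ?thesis using 1 2 by linarith
  qed
  have "a * (\<Sum>j\<in>J. G j) - 2 * ?d * p * (\<Sum>j\<in>J. \<bar>G j\<bar>) - 2 * ?d * card J * \<eta> * ?V * a
      = (\<Sum>j\<in>J. a * G j - 2 * ?d * p * \<bar>G j\<bar> - \<eta> * ?V * (2 * ?d * a))"
    by (simp add: sum_subtractf sum_distrib_left mult_ac)
  also have "\<dots> \<le> (\<Sum>j\<in>J. (LINT \<omega>|M. H j \<bullet> ?Y j \<omega> - \<eta> * ?V * norm (?Y j \<omega>)))"
    by (intro sum_mono summand)
  also have "\<dots> = (LINT \<omega>|M. (\<Sum>j\<in>J. H j \<bullet> ?Y j \<omega> - \<eta> * ?V * norm (?Y j \<omega>)))"
    using Y_int by (intro Bochner_Integration.integral_sum[symmetric]) auto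
  also have "\<dots> \<le> (LINT \<omega>|M. measure lborel {x \<in> D. \<exists>k\<le>n. x + Z k \<omega> \<notin> D})"
  proof (rule integral_mono)
    show "integrable M (\<lambda>\<omega>. \<Sum>j\<in>J. H j \<bullet> ?Y j \<omega> - \<eta> * ?V * norm (?Y j \<omega>))"
      using Y_int by auto
    show "integrable M (\<lambda>\<omega>. measure lborel {x \<in> D. \<exists>k\<le>n. x + Z k \<omega> \<notin> D})"
      by (rule expected_exit_volume(2)[OF D])
    fix \<omega>
    have "(\<Sum>j\<in>J. H j \<bullet> ?Y j \<omega> - \<eta> * ?V * norm (?Y j \<omega>))
        \<le> (\<Sum>j\<in>J. LINT x:D|lborel. \<psi> j x - \<psi> j (x - ?Y j \<omega>))"
      by (intro sum_mono pathwise norm_truncated_peak_le \<rho>)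
    also have "\<dots> \<le> measure lborel {x \<in> D. \<exists>k\<le>n. x + Z k \<omega> \<notin> D}"
    proof (rule exit_volume_lower_bound[OF D \<open>finite J\<close> _ nonneg le1])
      show "continuous_on UNIV (\<psi> j)" if "j \<in> J" for j
        by (rule C1_gradient_continuous(1)[OF C1[OF that]])
      show "?Y j \<omega> = 0 \<or> (\<exists>k\<le>n. ?Y j \<omega> = Z k \<omega>)" for j
        using peak_mem[of n "\<nu> j" "\<lambda>k. Z k \<omega>"] by (simp add: truncated_peak_def)
    qed
    finally show "(\<Sum>j\<in>J. H j \<bullet> ?Y j \<omega> - \<eta> * ?V * norm (?Y j \<omega>))
        \<le> measure lborel {x \<in> D. \<exists>k\<le>n. x + Z k \<omega> \<notin> D}" .
  qed
  also have "\<dots> = ?V - (LINT x:D|lborel. prob {\<omega> \<in> space M. \<forall>k\<le>n. x + Z k \<omega> \<in> D})"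
    by (rule expected_exit_volume(1)[OF D])
  finally show ?thesis .
qed

end

section \<open>Sampling a cadlag path at countably many times\<close>

text \<open>One-sided limits bound the path near each point of the compact interval.\<close>

lemma cadlag_bounded:
  fixes f :: "real \<Rightarrow> 'a::real_normed_vector"
  assumes "cadlag f"
  shows "bounded (f ` {0..t})"
proof -
  have "\<exists>B U. open U \<and> s \<in> U \<and> (\<forall>u\<in>U. u \<ge> 0 \<longrightarrow> norm (f u) \<le> B)" if s: "s \<in> {0..t}" for s
  proof -
    have right: "eventually (\<lambda>u. norm (f u) < norm (f s) + 1) (at_right s)"
    proof (rule order_tendstoD)
      have "(f \<longlongrightarrow> f s) (at_right s)" using assms s by (auto simp: cadlag_def)
      then show "((\<lambda>u. norm (f u)) \<longlongrightarrow> norm (f s)) (at_right s)" by (rule tendsto_norm)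
    qed simp
    obtain C where left: "eventually (\<lambda>u. u \<ge> 0 \<longrightarrow> norm (f u) < C) (at_left s)"
    proof (cases "s > 0")
      case True
      then obtain l where "(f \<longlongrightarrow> l) (at_left s)" using assms by (auto simp: cadlag_def)
      then have "eventually (\<lambda>u. norm (f u) < norm l + 1) (at_left s)"
        by (intro order_tendstoD(2)[OF tendsto_norm]) auto
      then have "eventually (\<lambda>u. u \<ge> 0 \<longrightarrow> norm (f u) < norm l + 1) (at_left s)"
        by eventually_elim simp
      then show ?thesis by (rule that)
    next
      case False
      \<comment> \<open>Here \<open>s = 0\<close>, and there is nothing to bound to the left of \<open>s\<close>.\<close>
      then have "eventually (\<lambda>u. u \<ge> 0 \<longrightarrow> norm (f u) < 0) (at_left s)"
        using s by (auto simp: eventually_at_filter)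
      then show ?thesis by (rule that)
    qed
    let ?B = "max (norm (f s) + 1) C"
    have "eventually (\<lambda>u. u \<ge> 0 \<longrightarrow> norm (f u) \<le> ?B) (at s)"
      unfolding at_eq_sup_left_right eventually_sup
      by (intro conjI eventually_mono[OF left] eventually_mono[OF right]) auto
    then have "eventually (\<lambda>u. u \<ge> 0 \<longrightarrow> norm (f u) \<le> ?B) (nhds s)"
      by (auto simp: eventually_nhds_conv_at)
    then obtain U where "open U" "s \<in> U" "\<forall>u\<in>U. u \<ge> 0 \<longrightarrow> norm (f u) \<le> ?B"
      unfolding eventually_nhds by blast
    then show ?thesis by blast
  qed
  then obtain B U where BU: "\<And>s. s \<in> {0..t} \<Longrightarrow> open (U s)" "\<And>s. s \<in> {0..t} \<Longrightarrow> s \<in> U s"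
    "\<And>s u. s \<in> {0..t} \<Longrightarrow> u \<in> U s \<Longrightarrow> u \<ge> 0 \<Longrightarrow> norm (f u) \<le> B s"
    by metis
  obtain S where S: "S \<subseteq> {0..t}" "finite S" "{0..t} \<subseteq> (\<Union>s\<in>S. U s)"
    by (rule compactE_image[of "{0..t}" "{0..t}" U]) (use BU in auto)
  have "norm (f u) \<le> (\<Sum>s\<in>S. \<bar>B s\<bar>)" if u: "u \<in> {0..t}" for u
  proof -
    obtain s where s: "s \<in> S" "u \<in> U s" using S(3) u by blast
    have "norm (f u) \<le> \<bar>B s\<bar>" using BU(3)[of s u] s u S(1) by force
    also have "\<dots> \<le> (\<Sum>s\<in>S. \<bar>B s\<bar>)" using s S(2) by (intro member_le_sum) auto
    finally show ?thesis .
  qed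
  then show ?thesis unfolding bounded_iff by blast
qed

text \<open>
  An enumeration, starting with \<open>0\<close>, of the rational points of \<open>[0, t]\<close> together with \<open>t\<close>.  The end point
  is included because right continuity says nothing about it.
\<close>

definition sampling_time :: "real \<Rightarrow> nat \<Rightarrow> real" where
  "sampling_time t k = (if k = 0 then 0 else from_nat_into (insert t ({0..t} \<inter> \<rat>)) (k - 1))"

lemma sampling_time_0 [simp]: "sampling_time t 0 = 0"
  by (simp add: sampling_time_def)

lemma sampling_time_mem: "t \<ge> 0 \<Longrightarrow> sampling_time t k \<in> {0..t}"
  using from_nat_into[of "insert t ({0..t} \<inter> \<rat>)" "k - 1"] by (auto simp: sampling_time_def)

lemma sampling_time_dense:
  assumes "t \<ge> 0" "s \<in> {0..t}" "eventually Q (at_right s)" "Q s"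
  shows "\<exists>k. Q (sampling_time t k)"
proof -
  have "\<exists>q\<in>insert t ({0..t} \<inter> \<rat>). Q q"
  proof (cases "s = t")
    case False
    obtain b where b: "b > s" "\<And>u. s < u \<Longrightarrow> u < b \<Longrightarrow> Q u"
      using assms(3) unfolding eventually_at_right_field by blast
    obtain q where "q \<in> \<rat>" "s < q" "q < min b t"
      using Rats_dense_in_real[of s "min b t"] b False assms(2) by auto
    then show ?thesis using b assms(2) by (intro bexI[of _ q]) auto
  qed (use assms in auto)
  then obtain q where q: "q \<in> insert t ({0..t} \<inter> \<rat>)" "Q q" by blast
  have "countable (insert t ({0..t} \<inter> \<rat>))" by (simp add: countable_rat)
  then obtain k where "from_nat_into (insert t ({0..t} \<inter> \<rat>)) k = q"
    using from_nat_into_surj[OF _ q(1)] by metis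
  then have "sampling_time t (Suc k) = q" by (simp add: sampling_time_def)
  then show ?thesis using q(2) by blast
qed

lemma
  fixes f :: "real \<Rightarrow> 'a::euclidean_space"
  assumes "cadlag f" "t \<ge> 0"
  shows peak_le_SUP: "peak e (\<lambda>k. f (sampling_time t k)) n \<bullet> e \<le> (SUP s\<in>{0..t}. f s \<bullet> e)"
    and peak_tendsto_SUP:
      "(\<lambda>n. peak e (\<lambda>k. f (sampling_time t k)) n \<bullet> e) \<longlonglongrightarrow> (SUP s\<in>{0..t}. f s \<bullet> e)"
proof -
  let ?m = "\<lambda>n. peak e (\<lambda>k. f (sampling_time t k)) n \<bullet> e"
  let ?S = "SUP s\<in>{0..t}. f s \<bullet> e"
  have "bounded ((\<lambda>v. v \<bullet> e) ` f ` {0..t})"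
    by (intro bounded_linear_image cadlag_bounded assms bounded_linear_inner_left)
  then have bdd: "bdd_above ((\<lambda>s. f s \<bullet> e) ` {0..t})"
    by (simp add: image_image bounded_imp_bdd_above)
  show le: "?m n \<le> ?S" for n
  proof -
    obtain k where "peak e (\<lambda>k. f (sampling_time t k)) n = f (sampling_time t k)"
      using peak_mem[of n e] by blast
    then show ?thesis
      using cSUP_upper[OF sampling_time_mem[OF assms(2)] bdd] by simp
  qed
  show "?m \<longlonglongrightarrow> ?S"
  proof (rule order_tendstoI)
    fix r assume "r < ?S"
    then obtain s where s: "s \<in> {0..t}" "r < f s \<bullet> e"
      using less_cSUP_iff[OF _ bdd] assms(2) by auto
    have "((\<lambda>u. f u \<bullet> e) \<longlongrightarrow> f s \<bullet> e) (at_right s)"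
      using assms(1) s(1) by (intro tendsto_inner tendsto_const) (auto simp: cadlag_def)
    then have "eventually (\<lambda>u. r < f u \<bullet> e) (at_right s)"
      using s(2) by (rule order_tendstoD)
    then obtain k where "r < f (sampling_time t k) \<bullet> e"
      using sampling_time_dense[OF assms(2) s(1)] s(2) by blast
    then have "r < ?m n" if "n \<ge> k" for n
      using peak_ge[OF that, of "\<lambda>k. f (sampling_time t k)" e] by simp
    then show "eventually (\<lambda>n. r < ?m n) sequentially"
      by (rule eventually_sequentiallyI)
  next
    fix r assume "?S < r"
    then show "eventually (\<lambda>n. ?m n < r) sequentially"
      using le by (intro always_eventually allI) (rule le_less_trans)
  qed
qed

section \<open>The process sampled along a sequence of times\<close>

lemma distr_process_law:
  fixes X :: "real \<Rightarrow> 'w \<Rightarrow> real^'n"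
  assumes meas: "\<And>t. t \<ge> 0 \<Longrightarrow> X t \<in> borel_measurable M" and c: "\<And>k. c k \<ge> 0"
  shows "distr (process_law M X) (\<Pi>\<^sub>M k\<in>(UNIV :: nat set). borel) (\<lambda>f k. f (c k))
       = distr M (\<Pi>\<^sub>M k\<in>UNIV. borel) (\<lambda>\<omega> k. X (c k) \<omega>)"
proof -
  have 1: "(\<lambda>\<omega>. \<lambda>t\<in>{0..}. X t \<omega>) \<in> M \<rightarrow>\<^sub>M (\<Pi>\<^sub>M t\<in>{0..}. borel)"
    using meas by (intro measurable_restrict) auto
  have 2: "(\<lambda>f k. f (c k)) \<in> (\<Pi>\<^sub>M t\<in>{0..}. borel :: (real^'n) measure) \<rightarrow>\<^sub>M (\<Pi>\<^sub>M k\<in>(UNIV :: nat set). borel)"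
    using c by (intro measurable_PiM_single') (auto intro: measurable_component_singleton)
  have "(\<lambda>f k. f (c k)) \<circ> (\<lambda>\<omega>. \<lambda>t\<in>{0..}. X t \<omega>) = (\<lambda>\<omega> k. X (c k) \<omega>)"
    using c by (auto simp: fun_eq_iff)
  then show ?thesis
    unfolding process_law_def by (simp add: distr_distr[OF 2 1])
qed

lemma cadlag_process_measurable:
  assumes "cadlag_process P X" "t \<ge> 0"
  shows "X t \<in> borel_measurable (P x)"
proof -
  have "sets (P x) = sets (P 0)" "X t \<in> borel_measurable (P 0)"
    using assms unfolding cadlag_process_def by blast+
  then show ?thesis using measurable_cong_sets by blast
qed

lemma isotropic_sequence_sampling:
  fixes X :: "real \<Rightarrow> 'w \<Rightarrow> real^'n"
  assumes X: "cadlag_process P X" and iso: "isotropic P X" and "t \<ge> 0"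
  shows "isotropic_sequence (P 0) (\<lambda>k. X (sampling_time t k))"
proof -
  have c: "sampling_time t k \<ge> 0" for k using sampling_time_mem[OF \<open>t \<ge> 0\<close>, of k] by simp
  interpret prob_space "P 0" using X by (simp add: cadlag_process_def)
  note meas = cadlag_process_measurable[OF X]
  show ?thesis
  proof
    show "X (sampling_time t k) \<in> borel_measurable (P 0)" for k by (rule meas[OF c])
    show "AE \<omega> in P 0. X (sampling_time t 0) \<omega> = 0" using X by (auto simp: cadlag_process_def)
    fix U :: "real^'n^'n" assume U: "orthogonal_matrix U"
    have mU: "(\<lambda>\<omega>. U *v X s \<omega>) \<in> borel_measurable (P 0)" if "s \<ge> 0" for s
    proof -
      have [measurable]: "(\<lambda>v. U *v v) \<in> borel_measurable borel"
        by (intro borel_measurable_continuous_onI linear_continuous_on matrix_vector_mul_bounded_linear)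
      show ?thesis using meas[OF that, of 0] by measurable
    qed
    have "process_law (P 0) X = process_law (P 0) (\<lambda>t \<omega>. U *v X t \<omega>)"
      using iso U by (simp add: isotropic_def)
    then show "distr (P 0) (\<Pi>\<^sub>M k\<in>UNIV. borel) (\<lambda>\<omega> k. X (sampling_time t k) \<omega>)
      = distr (P 0) (\<Pi>\<^sub>M k\<in>UNIV. borel) (\<lambda>\<omega> k. U *v X (sampling_time t k) \<omega>)"
      using distr_process_law[of X "P 0" "sampling_time t", OF meas c]
        distr_process_law[of "\<lambda>s \<omega>. U *v X s \<omega>" "P 0" "sampling_time t", OF mU c]
      by simp
  qed
qed

lemma translated_stay_probability:
  fixes X :: "real \<Rightarrow> 'w \<Rightarrow> real^'n"
  assumes X: "cadlag_process P X" and trans: "translation_invariant P X"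
    and c: "\<And>k. c k \<ge> 0" and [measurable]: "D \<in> sets borel"
  shows "measure (P x) {\<omega> \<in> space (P x). \<forall>k\<le>(n::nat). X (c k) \<omega> \<in> D}
       = measure (P 0) {\<omega> \<in> space (P 0). \<forall>k\<le>n. x + X (c k) \<omega> \<in> D}"
proof -
  let ?N = "\<Pi>\<^sub>M k\<in>(UNIV :: nat set). borel :: (real^'n) measure"
  let ?B = "{z \<in> space ?N. \<forall>k\<le>n. z k \<in> D}"
  note meas = cadlag_process_measurable[OF X]
  have meas': "(\<lambda>\<omega>. X s \<omega> + x) \<in> borel_measurable (P 0)" if "s \<ge> 0" for s
    using meas[OF that, of 0] by measurable
  have B: "?B \<in> sets ?N" by measurable
  have law: "distr (P x) ?N (\<lambda>\<omega> k. X (c k) \<omega>) = distr (P 0) ?N (\<lambda>\<omega> k. X (c k) \<omega> + x)"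
    using trans distr_process_law[of X "P x" c, OF meas c]
      distr_process_law[of "\<lambda>s \<omega>. X s \<omega> + x" "P 0" c, OF meas' c]
    unfolding translation_invariant_def by metis
  have m1: "(\<lambda>\<omega> k. X (c k) \<omega>) \<in> P x \<rightarrow>\<^sub>M ?N"
    using meas c by (intro measurable_PiM_single') auto
  have m2: "(\<lambda>\<omega> k. X (c k) \<omega> + x) \<in> P 0 \<rightarrow>\<^sub>M ?N"
    using meas' c by (intro measurable_PiM_single') auto
  have "measure (P x) ((\<lambda>\<omega> k. X (c k) \<omega>) -` ?B \<inter> space (P x))
      = measure (P 0) ((\<lambda>\<omega> k. X (c k) \<omega> + x) -` ?B \<inter> space (P 0))"
    using arg_cong[OF law, of "\<lambda>L. measure L ?B"] measure_distr[OF m1 B] measure_distr[OF m2 B] by simp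
  moreover have "(\<lambda>\<omega> k. X (c k) \<omega>) -` ?B \<inter> space (P x) = {\<omega> \<in> space (P x). \<forall>k\<le>n. X (c k) \<omega> \<in> D}"
    by (auto simp: space_PiM)
  moreover have "(\<lambda>\<omega> k. X (c k) \<omega> + x) -` ?B \<inter> space (P 0) = {\<omega> \<in> space (P 0). \<forall>k\<le>n. x + X (c k) \<omega> \<in> D}"
    by (auto simp: space_PiM add.commute)
  ultimately show ?thesis by simp
qed

text \<open>
  The event on the left need not be measurable: if it is not, its measure is \<open>0\<close> and the inequality is
  trivial.
\<close>

lemma survival_probability_le:
  fixes X :: "real \<Rightarrow> 'w \<Rightarrow> real^'n"
  assumes X: "cadlag_process P X" and trans: "translation_invariant P X"
    and c: "\<And>k. c k \<in> {0..t}" and [measurable]: "D \<in> sets borel"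
  shows "measure (completion (P x)) {\<omega> \<in> space (P x). ereal t < exit_time X D \<omega>}
       \<le> measure (P 0) {\<omega> \<in> space (P 0). \<forall>k\<le>(n::nat). x + X (c k) \<omega> \<in> D}"
proof -
  let ?A = "{\<omega> \<in> space (P x). ereal t < exit_time X D \<omega>}"
  let ?B = "{\<omega> \<in> space (P x). \<forall>k\<le>n. X (c k) \<omega> \<in> D}"
  interpret prob_space "P x" using X by (simp add: cadlag_process_def)
  interpret C: prob_space "completion (P x)" by (rule prob_space_completion)
  have c0: "c k \<ge> 0" for k using c[of k] by simp
  have [measurable]: "X (c k) \<in> borel_measurable (P x)" for k
    by (rule cadlag_process_measurable[OF X c0])
  have B: "?B \<in> sets (P x)" by measurable
  have "?A \<subseteq> ?B"
  proof safe
    fix \<omega> k assume "ereal t < exit_time X D \<omega>"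
    show "X (c k) \<omega> \<in> D"
    proof (rule ccontr)
      assume "X (c k) \<omega> \<notin> D"
      then have "exit_time X D \<omega> \<le> ereal (c k)"
        unfolding exit_time_def using c0 by (intro Inf_lower) auto
      also have "\<dots> \<le> ereal t" using c[of k] by simp
      finally show False using \<open>ereal t < exit_time X D \<omega>\<close> by simp
    qed
  qed
  have "measure (completion (P x)) ?A \<le> measure (completion (P x)) ?B"
    using \<open>?A \<subseteq> ?B\<close> B by (intro C.finite_measure_mono) auto
  also have "\<dots> = measure (P x) ?B" using B by (simp add: measure_def)
  also have "\<dots> = measure (P 0) {\<omega> \<in> space (P 0). \<forall>k\<le>n. x + X (c k) \<omega> \<in> D}"
    by (rule translated_stay_probability[OF X trans c0]) measurable
  finally show ?thesis .
qed

lemma spectral_heat_content_le: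
  fixes X :: "real \<Rightarrow> 'w \<Rightarrow> real^'n"
  assumes X: "cadlag_process P X" "translation_invariant P X" "isotropic P X"
    and D: "open D" "bounded D" and "t \<ge> 0"
  shows "spectral_heat_content P X D t
    \<le> (LINT x:D|lborel. measure (P 0) {\<omega> \<in> space (P 0). \<forall>k\<le>n. x + X (sampling_time t k) \<omega> \<in> D})"
proof -
  have D_sets [measurable]: "D \<in> sets borel" using D(1) by simp
  interpret isotropic_sequence "P 0" "\<lambda>k. X (sampling_time t k)"
    by (rule isotropic_sequence_sampling[OF X(1,3) \<open>t \<ge> 0\<close>])
  let ?q = "\<lambda>x. measure (completion (P x)) {\<omega> \<in> space (P x). ereal t < exit_time X D \<omega>}"
  let ?s = "\<lambda>x. prob {\<omega> \<in> space (P 0). \<forall>k\<le>n. x + X (sampling_time t k) \<omega> \<in> D}"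
  have qs: "?q x \<le> ?s x" for x
    by (rule survival_probability_le[OF X(1,2) sampling_time_mem[OF \<open>t \<ge> 0\<close>] D_sets])
  have m: "(\<lambda>x. indicator D x *\<^sub>R ?s x) \<in> borel_measurable lborel"
    using measurable_stay_probability[OF D_sets, of n] by simp
  have s_int: "integrable lebesgue (\<lambda>x. indicator D x *\<^sub>R ?s x)"
    using stay_probability_integrable[OF D, of n]
    by (simp add: integrable_completion[OF m] set_integrable_def del: real_scaleR_def)
  have "spectral_heat_content P X D t \<le> (LINT x|lebesgue. indicator D x *\<^sub>R ?s x)"
  proof (cases "integrable lebesgue (\<lambda>x. indicator D x *\<^sub>R ?q x)")
    case True
    then show ?thesis
      unfolding spectral_heat_content_def set_lebesgue_integral_def using s_int qs
      by (intro integral_mono) (auto intro: mult_left_mono)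
  next
    \<comment> \<open>The integral of a function that is not integrable is \<open>0\<close>.\<close>
    case False
    then show ?thesis
      unfolding spectral_heat_content_def set_lebesgue_integral_def
      by (simp add: not_integrable_integral_eq)
  qed
  also have "\<dots> = (LINT x:D|lborel. ?s x)"
    unfolding set_lebesgue_integral_def by (rule integral_completion[OF m])
  finally show ?thesis .
qed

text \<open>The maxima over more and more sampling times increase to the running supremum.\<close>

lemma height_approximates_running_sup:
  fixes X :: "real \<Rightarrow> 'w \<Rightarrow> real^'n"
  assumes X: "cadlag_process P X" "isotropic P X" and "t \<ge> 0"
  defines "h \<equiv> isotropic_sequence.height (\<lambda>k. X (sampling_time t k))"
  shows "measure (P 0) {\<omega> \<in> space (P 0). h n (axis i 1) \<omega> > r}
           \<le> measure (P 0) {\<omega> \<in> space (P 0). running_sup X i t \<omega> > r}"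
    and "(LINT \<omega>|P 0. min (h n (axis i 1) \<omega>) 1) \<le> mean_running_sup P X i t"
    and "(\<lambda>n. LINT \<omega>|P 0. min (h n (axis i 1) \<omega>) 1) \<longlonglongrightarrow> mean_running_sup P X i t"
proof -
  interpret isotropic_sequence "P 0" "\<lambda>k. X (sampling_time t k)"
    by (rule isotropic_sequence_sampling[OF X \<open>t \<ge> 0\<close>])
  let ?e = "axis i 1 :: real^'n"
  have cad: "cadlag (\<lambda>s. X s \<omega>)" if "\<omega> \<in> space (P 0)" for \<omega>
    using X(1) that by (simp add: cadlag_process_def)
  have rs: "running_sup X i t \<omega> = (SUP s\<in>{0..t}. X s \<omega> \<bullet> ?e)" for \<omega>
    by (simp add: running_sup_def inner_axis)
  have le: "height n ?e \<omega> \<le> running_sup X i t \<omega>" if "\<omega> \<in> space (P 0)" for n \<omega>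
    unfolding rs height_def using peak_le_SUP[OF cad[OF that] \<open>t \<ge> 0\<close>] .
  have lim: "(\<lambda>n. height n ?e \<omega>) \<longlonglongrightarrow> running_sup X i t \<omega>" if "\<omega> \<in> space (P 0)" for \<omega>
    unfolding rs height_def using peak_tendsto_SUP[OF cad[OF that] \<open>t \<ge> 0\<close>] .
  have [measurable]: "running_sup X i t \<in> borel_measurable (P 0)"
    by (rule borel_measurable_LIMSEQ_real[OF lim measurable_height])
  have ge0: "AE \<omega> in P 0. running_sup X i t \<omega> \<ge> 0"
    using height_nonneg[of 0 ?e] AE_space
    by eventually_elim (use le order_trans in blast)
  have int: "integrable (P 0) (\<lambda>\<omega>. min (running_sup X i t \<omega>) 1)"
    by (rule integrable_const_bound[of _ 1]) (use ge0 in \<open>auto elim!: eventually_mono\<close>)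
  show "measure (P 0) {\<omega> \<in> space (P 0). h n ?e \<omega> > r} \<le> measure (P 0) {\<omega> \<in> space (P 0). running_sup X i t \<omega> > r}"
    unfolding h_def using le by (intro finite_measure_mono) (auto intro: less_le_trans)
  show "(LINT \<omega>|P 0. min (h n ?e \<omega>) 1) \<le> mean_running_sup P X i t"
    unfolding h_def mean_running_sup_def
    using le by (intro integral_mono truncated_height_integrable int) (auto simp: min_le_iff_disj)
  show "(\<lambda>n. LINT \<omega>|P 0. min (h n ?e \<omega>) 1) \<longlonglongrightarrow> mean_running_sup P X i t"
    unfolding h_def mean_running_sup_def
  proof (rule integral_dominated_convergence[where w = "\<lambda>_. 1"])
    show "AE \<omega> in P 0. (\<lambda>n. min (height n ?e \<omega>) 1) \<longlonglongrightarrow> min (running_sup X i t \<omega>) 1"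
      using lim by (intro AE_I2 tendsto_min tendsto_const) auto
    show "AE \<omega> in P 0. norm (min (height n ?e \<omega>) 1) \<le> 1" for n
      using height_nonneg[of n ?e] by (auto elim!: eventually_mono)
  qed auto
qed

section \<open>The lower bound for the heat loss\<close>

text \<open>
  For each small \<open>t\<close> the process is sampled at so many times that the truncated mean \<open>a\<close> of the sampled
  maximum is within a factor \<open>1 - \<eta>\<close> of \<open>mean_running_sup P X i t\<close>.
\<close>

lemma heat_loss_directional_lower_bound:
  fixes X :: "real \<Rightarrow> 'w \<Rightarrow> real^'n" and \<nu> :: "'j \<Rightarrow> real^'n"
  assumes D: "open D" "bounded D"
    and X: "cadlag_process P X" "translation_invariant P X" "isotropic P X"
    and pos: "\<forall>\<^sub>F t in at_right 0. 0 < mean_running_sup P X i t"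
    and tail: "\<And>\<epsilon>. \<epsilon> > 0 \<Longrightarrow>
       ((\<lambda>t. measure (P 0) {\<omega> \<in> space (P 0). running_sup X i t \<omega> > \<epsilon>} / mean_running_sup P X i t)
          \<longlongrightarrow> 0) (at_right 0)"
    and J: "finite J"
    and C1: "\<And>j. j \<in> J \<Longrightarrow> C1_gradient (\<psi> j) (g j)"
    and nonneg: "\<And>j x. j \<in> J \<Longrightarrow> \<psi> j x \<ge> 0"
    and le1: "\<And>x. (\<Sum>j\<in>J. \<psi> j x) \<le> 1"
    and unit: "\<And>j. j \<in> J \<Longrightarrow> norm (\<nu> j) = 1"
    and "\<delta> > 0"
  shows "\<forall>\<^sub>F t in at_right 0. (\<Sum>j\<in>J. LINT x:D|lborel. g j x \<bullet> \<nu> j) - \<delta>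
     \<le> (measure lebesgue D - spectral_heat_content P X D t) / mean_running_sup P X i t"
proof -
  define G where "G j = (LINT x:D|lborel. g j x \<bullet> \<nu> j)" for j
  let ?d = "real CARD('n)"
  let ?V = "measure lborel D"
  let ?\<mu> = "mean_running_sup P X i"
  let ?e = "axis i 1 :: real^'n"
  define B where "B = (\<Sum>j\<in>J. \<bar>G j\<bar>)"
  \<comment> \<open>All errors together amount to at most \<open>\<eta> * K\<close> times the mean running supremum.\<close>
  define K where "K = B + 2 * ?d * B + 2 * ?d * card J * ?V"
  have B0: "B \<ge> 0" unfolding B_def by (intro sum_nonneg) auto
  have K0: "K \<ge> 0" unfolding K_def using B0 by simp
  define \<eta> where "\<eta> = \<delta> / (K + 1)"
  have \<eta>: "\<eta> > 0" "\<eta> * K \<le> \<delta>"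
    using \<open>\<delta> > 0\<close> K0 by (auto simp: \<eta>_def field_simps)
  have "\<exists>\<rho>>0. \<forall>x\<in>D. \<forall>y. norm y \<le> \<rho> \<longrightarrow> \<bar>\<psi> j x - \<psi> j (x - y) - g j x \<bullet> y\<bar> \<le> \<eta> * norm y"
    if "j \<in> J" for j
    by (rule C1_gradient_taylor[OF C1[OF that] D(2) \<eta>(1)])
  then obtain r where r: "\<And>j. j \<in> J \<Longrightarrow> r j > 0"
    "\<And>j x y. j \<in> J \<Longrightarrow> x \<in> D \<Longrightarrow> norm y \<le> r j \<Longrightarrow>
      \<bar>\<psi> j x - \<psi> j (x - y) - g j x \<bullet> y\<bar> \<le> \<eta> * norm y"
    by metis
  define \<rho> where "\<rho> = Min (insert 1 (r ` J))"
  have \<rho>: "\<rho> > 0" "\<rho> \<le> 1" "\<And>j. j \<in> J \<Longrightarrow> \<rho> \<le> r j"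
    using J r(1) by (auto simp: \<rho>_def)
  have taylor: "\<bar>\<psi> j x - \<psi> j (x - y) - g j x \<bullet> y\<bar> \<le> \<eta> * norm y"
    if "j \<in> J" "x \<in> D" "norm y \<le> \<rho>" for j x y
    by (rule r(2)[OF that(1,2) order_trans[OF that(3) \<rho>(3)[OF that(1)]]])
  have "\<forall>\<^sub>F t in at_right 0. measure (P 0) {\<omega> \<in> space (P 0). running_sup X i t \<omega> > \<rho> / ?d} / ?\<mu> t < \<eta>"
    using \<rho>(1) \<eta>(1) by (intro order_tendstoD(2)[OF tail]) auto
  then show ?thesis
    using pos eventually_at_right_less[of "0 :: real"]
  proof eventually_elim
    case (elim t)
    then have t: "t \<ge> 0" and \<mu>: "?\<mu> t > 0" by auto
    interpret isotropic_sequence "P 0" "\<lambda>k. X (sampling_time t k)"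
      by (rule isotropic_sequence_sampling[OF X(1,3) t])
    note approx = height_approximates_running_sup[OF X(1,3) t, where i = i]
    have "(1 - \<eta>) * ?\<mu> t < ?\<mu> t" using \<mu> \<eta>(1) by (simp add: algebra_simps)
    then obtain n where n: "(1 - \<eta>) * ?\<mu> t < (LINT \<omega>|P 0. min (height n ?e \<omega>) 1)"
      using order_tendstoD(1)[OF approx(3)] by (meson eventually_sequentially order_refl)
    define a where "a = (LINT \<omega>|P 0. min (height n ?e \<omega>) 1)"
    define p where "p = prob {\<omega> \<in> space (P 0). height n ?e \<omega> > \<rho> / ?d}"
    have a: "a \<le> ?\<mu> t" "\<bar>a - ?\<mu> t\<bar> \<le> \<eta> * ?\<mu> t"
      using approx(2)[of n] n by (auto simp: a_def algebra_simps)
    have "p \<le> measure (P 0) {\<omega> \<in> space (P 0). running_sup X i t \<omega> > \<rho> / ?d}"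
      unfolding p_def by (rule approx(1))
    also have "\<dots> \<le> \<eta> * ?\<mu> t" using elim(1) \<mu> by (simp add: pos_divide_less_eq)
    finally have p: "p \<le> \<eta> * ?\<mu> t" .
    have "a * sum G J - 2 * ?d * p * B - 2 * ?d * card J * \<eta> * ?V * a
      \<le> ?V - (LINT x:D|lborel. prob {\<omega> \<in> space (P 0). \<forall>k\<le>n. x + X (sampling_time t k) \<omega> \<in> D})"
      unfolding a_def p_def B_def G_def
      by (rule exit_volume_mean_lower_bound[OF D J C1 nonneg le1 unit])
        (use \<rho>(1,2) \<eta>(1) taylor in \<open>auto simp: norm_axis_1\<close>)
    also have "\<dots> \<le> measure lebesgue D - spectral_heat_content P X D t"
      using spectral_heat_content_le[OF X D t, of n] D(1) by simp
    finally have main: "a * sum G J - 2 * ?d * p * B - 2 * ?d * card J * \<eta> * ?V * a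
      \<le> measure lebesgue D - spectral_heat_content P X D t" .
    have "\<bar>(a - ?\<mu> t) * sum G J\<bar> \<le> (\<eta> * ?\<mu> t) * B"
      unfolding abs_mult B_def using a(2) by (intro mult_mono sum_abs) auto
    then have 1: "?\<mu> t * sum G J - \<eta> * ?\<mu> t * B \<le> a * sum G J"
      by (simp add: left_diff_distrib abs_le_iff)
    have 2: "2 * ?d * p * B \<le> 2 * ?d * (\<eta> * ?\<mu> t) * B"
      using p B0 by (intro mult_right_mono mult_left_mono) auto
    have 3: "2 * ?d * card J * \<eta> * ?V * a \<le> 2 * ?d * card J * \<eta> * ?V * ?\<mu> t"
      using a(1) \<eta>(1) by (intro mult_left_mono) auto
    have "(sum G J - \<delta>) * ?\<mu> t \<le> (sum G J - \<eta> * K) * ?\<mu> t"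
      using \<eta>(2) \<mu> by (intro mult_right_mono) auto
    also have "\<dots> = ?\<mu> t * sum G J - \<eta> * ?\<mu> t * B - 2 * ?d * (\<eta> * ?\<mu> t) * B
        - 2 * ?d * card J * \<eta> * ?V * ?\<mu> t"
      by (simp add: K_def algebra_simps)
    also have "\<dots> \<le> measure lebesgue D - spectral_heat_content P X D t"
      using main 1 2 3 by linarith
    finally show ?case
      using \<mu> by (simp add: pos_le_divide_eq G_def)
  qed
qed

text \<open>The limit \<open>c \<rightarrow> 1\<close> in the decomposition of \<open>\<phi> / c\<close>.\<close>

lemma heat_loss_divergence_lower_bound:
  fixes X :: "real \<Rightarrow> 'w \<Rightarrow> real^'n" and \<phi> :: "real^'n \<Rightarrow> real^'n"
  assumes D: "open D" "bounded D"
    and X: "cadlag_process P X" "translation_invariant P X" "isotropic P X"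
    and pos: "\<forall>\<^sub>F t in at_right 0. 0 < mean_running_sup P X i t"
    and tail: "\<And>\<epsilon>. \<epsilon> > 0 \<Longrightarrow>
       ((\<lambda>t. measure (P 0) {\<omega> \<in> space (P 0). running_sup X i t \<omega> > \<epsilon>} / mean_running_sup P X i t)
          \<longlongrightarrow> 0) (at_right 0)"
    and C1: "\<And>k. C1_gradient (\<lambda>x. \<phi> x $ k) (G k)" and le1: "\<And>x. norm (\<phi> x) \<le> 1"
    and r: "r < (LINT x:D|lborel. \<Sum>k\<in>UNIV. G k x $ k)"
  shows "\<forall>\<^sub>F t in at_right 0.
     r \<le> (measure lebesgue D - spectral_heat_content P X D t) / mean_running_sup P X i t"
proof -
  define I where "I = (LINT x:D|lborel. \<Sum>k\<in>UNIV. G k x $ k)"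
  have "((\<lambda>c. I / c) \<longlongrightarrow> I / 1) (at_right 1)" by (intro tendsto_intros) auto
  then have "\<forall>\<^sub>F c in at_right 1. r < I / c" by (rule order_tendstoD) (use r in \<open>simp add: I_def\<close>)
  moreover have "\<forall>\<^sub>F c :: real in at_right 1. 1 < c" by (rule eventually_at_right_less)
  ultimately have "\<forall>\<^sub>F c in at_right 1. r < I / c \<and> 1 < c" by (rule eventually_conj)
  then obtain c where c: "r < I / c" "c > 1"
    using eventually_happens[of _ "at_right (1 :: real)"] by (auto simp: trivial_limit_at_right_real)
  obtain J :: "('n \<Rightarrow> nat) set" and \<nu> \<psi> g where J: "finite J" "\<And>j. j \<in> J \<Longrightarrow> norm (\<nu> j) = 1"
    "\<And>j. j \<in> J \<Longrightarrow> C1_gradient (\<psi> j) (g j)" "\<And>j x. j \<in> J \<Longrightarrow> \<psi> j x \<ge> 0"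
    "\<And>x. (\<Sum>j\<in>J. \<psi> j x) \<le> 1"
    "\<And>x. c * (\<Sum>j\<in>J. g j x \<bullet> \<nu> j) = (\<Sum>k\<in>UNIV. G k x $ k)"
    by (rule directional_decomposition[OF C1 le1 c(2)]) blast
  have int: "set_integrable lborel D (\<lambda>x. g j x \<bullet> \<nu> j)" if "j \<in> J" for j
    using C1_gradient_continuous(2)[OF J(3)[OF that]] D
    by (intro set_integrable_continuous_bounded continuous_intros) auto
  have "I = (LINT x:D|lborel. c * (\<Sum>j\<in>J. g j x \<bullet> \<nu> j))" by (simp only: I_def J(6))
  also have "\<dots> = c * (LINT x|lborel. (\<Sum>j\<in>J. indicator D x * (g j x \<bullet> \<nu> j)))"
    by (simp add: set_lebesgue_integral_def sum_distrib_left[symmetric] mult.left_commute)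
  also have "(LINT x|lborel. (\<Sum>j\<in>J. indicator D x * (g j x \<bullet> \<nu> j))) = (\<Sum>j\<in>J. LINT x:D|lborel. g j x \<bullet> \<nu> j)"
    using int unfolding set_integrable_def set_lebesgue_integral_def
    by (subst Bochner_Integration.integral_sum) auto
  finally have "I / c = (\<Sum>j\<in>J. LINT x:D|lborel. g j x \<bullet> \<nu> j)" using c(2) by simp
  then show ?thesis
    using heat_loss_directional_lower_bound[where \<nu> = \<nu> and \<delta> = "I / c - r", OF D X pos tail J(1,3,4,5,2)]
      c(1) by simp
qed

theorem proposition5p1:
  fixes D :: "(real^'n) set"
    and P :: "real^'n \<Rightarrow> 'w measure"
    and X :: "real \<Rightarrow> 'w \<Rightarrow> real^'n"
    and i :: 'n
  assumes "open D" and "bounded D" and "perimeter D < \<infinity>"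
    and "cadlag_process P X"
    and "translation_invariant P X"
    and "isotropic P X"
    and "\<forall>\<^sub>F t in at_right 0. 0 < mean_running_sup P X i t"
    and "\<And>\<epsilon>. \<epsilon> > 0 \<Longrightarrow>
           ((\<lambda>t. measure (P 0) {\<omega> \<in> space (P 0). running_sup X i t \<omega> > \<epsilon>} / mean_running_sup P X i t)
              \<longlongrightarrow> 0) (at_right 0)"
  shows "Liminf (at_right 0)
           (\<lambda>t. ereal ((measure lebesgue D - spectral_heat_content P X D t) / mean_running_sup P X i t))
         \<ge> perimeter D"
  unfolding perimeter_def
proof (rule SUP_least, clarify)
  fix \<phi> :: "real^'n \<Rightarrow> real^'n"
  assume test: "\<forall>k. test_function (\<lambda>x. \<phi> x $ k)" and le1: "\<forall>x. (\<Sum>k\<in>UNIV. (\<phi> x $ k)\<^sup>2) \<le> 1"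
  define G :: "'n \<Rightarrow> real^'n \<Rightarrow> real^'n" where "G k x = (\<chi> l. partial_deriv l (\<lambda>x. \<phi> x $ k) x)" for k x
  have C1: "C1_gradient (\<lambda>x. \<phi> x $ k) (G k)" for k
    using test_function_C1_gradient[of "\<lambda>x. \<phi> x $ k"] test by (simp add: G_def[abs_def])
  have norm: "norm (\<phi> x) \<le> 1" for x
    using le1 by (simp add: norm_vec_def L2_set_def)
  have cont: "continuous_on UNIV (\<lambda>x. \<Sum>k\<in>UNIV. G k x $ k)"
    by (intro continuous_intros C1_gradient_continuous(2)[OF C1])
  then have [measurable]: "(\<lambda>x. \<Sum>k\<in>UNIV. G k x $ k) \<in> borel_measurable borel"
    by (rule borel_measurable_continuous_onI)
  have [measurable]: "D \<in> sets borel" using assms(1) by simp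
  let ?I = "LINT x:D|lebesgue. (\<Sum>k\<in>UNIV. partial_deriv k (\<lambda>y. \<phi> y $ k) x)"
  have "?I = (LINT x:D|lebesgue. (\<Sum>k\<in>UNIV. G k x $ k))" by (simp add: G_def)
  also have "\<dots> = (LINT x:D|lborel. \<Sum>k\<in>UNIV. G k x $ k)"
    unfolding set_lebesgue_integral_def by (rule integral_completion) measurable
  finally have I: "?I = (LINT x:D|lborel. \<Sum>k\<in>UNIV. G k x $ k)" .
  show "ereal ?I \<le> Liminf (at_right 0)
           (\<lambda>t. ereal ((measure lebesgue D - spectral_heat_content P X D t) / mean_running_sup P X i t))"
  proof (rule dense_le)
    fix y assume y: "y < ereal ?I"
    show "y \<le> Liminf (at_right 0)
           (\<lambda>t. ereal ((measure lebesgue D - spectral_heat_content P X D t) / mean_running_sup P X i t))"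
    proof (cases y)
      case (real r)
      then have "r < (LINT x:D|lborel. \<Sum>k\<in>UNIV. G k x $ k)" using y I by simp
      from heat_loss_divergence_lower_bound[OF assms(1,2,4-8) C1 norm this]
      show ?thesis unfolding real by (intro Liminf_bounded) (simp only: ereal_less_eq)
    qed (use y in auto)
  qed
qed

end
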